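(* Interpret the conditioning modality by: $\gamma,D,(\mathcal F,\mu)\vDash \mathsf C_{x:A\leftarrow E}P$ iff for all probability measures $\mu'$ on $\Sigma_\Omega$ with $(\Sigma_\Omega,\mu')\sqsupseteq(\mathcal F,\mu)$, all disintegrations $\{\nu_x\}_{x\in A}$ of $\mu'$ along $E(\gamma)\circ D$, and almost all $x\in A$ (with respect to the law of $E(\gamma)\circ D$ under $\mu'$), it holds that $(\gamma,x),D,(\mathcal F,\nu_x|_{\mathcal F})\vDash P$. Then this interpretation validates the following rules. (C-Entail) If $P\vdash Q$ then $\mathsf C_{x\leftarrow E}P\vdash\mathsf C_{x\leftarrow E}Q$. (C-Indep) $(\mathsf{own}\,E)*P\vdash\mathsf C_{x\leftarrow E}P$ (where $x$ does not occur in $P$). (C-Subst) $\mathsf{own}\,X\vdash\mathsf C_{x\leftarrow X}(X\overset{\mathsf{as}}{=}x)$. (C-Total-Expectation) $\mathsf C_{x\leftarrow X}(\mathbb E[E]=e)\ \land\ \mathbb E[e[X/x]]=v\ \vdash\ \mathbb E[E]=v$.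
   Context: RESOURCES. Let $\Omega=[0,1]^{\mathbb N}$ with its Borel $\sigma$-algebra $\Sigma_\Omega$ (product topology). Probability spaces are pairs $(\mathcal F,\mu)$ with $\mathcal F\subseteq\Sigma_\Omega$ a sub-$\sigma$-algebra and $\mu$ a probability measure on $\mathcal F$. $(\mathcal F,\mu)\sqsubseteq(\mathcal G,\nu)$ iff $\mathcal F\subseteq\mathcal G$ and $\mu=\nu|_{\mathcal F}$. A $\sigma$-algebra $\mathcal F$ has finite footprint if for some finite $n$ every $F\in\mathcal F$ has the form $F'\times[0,1]^{\mathbb N}$ with $F'\subseteq[0,1]^n$. Let $\mathfrak M$ be the set of probability spaces $(\mathcal F,\mu)$ such that $\mathcal F$ is countably generated and has finite footprint and $\mu$ extends to a probability measure on $\Sigma_\Omega$. For spaces in $\mathfrak M$, $(\mathcal E,\mu)\bullet(\mathcal F,\nu)$ is the (unique if existing) $(\mathcal G,\rho)\in\mathfrak M$ with $\mathcal G$ the smallest $\sigma$-algebra containing $\mathcal E,\mathcal F$ and $\rho(E\cap F)=\mu(E)\nu(F)$ for all $E\in\mathcal E,F\in\mathcal F$; otherwise undefined. $\mathbf 1$ is the space with $\sigma$-algebra $\{\emptyset,\Omega\}$. For a measurable space $A$, $\mathrm{RV}\,A$ is the set of measurable maps $\Omega\to A$ whose pullback $\sigma$-algebra has finite footprint. $\mathcal GA$ is the measurable space of probability measures on $A$. EXPRESSIONS. $\Gamma=x_1{:}S_1,\dots$ lists deterministic variables (sets), $\Delta=X_1{:}A_1,\dots$ lists random variables (measurable spaces);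 $[\![\Gamma]\!]=\prod S_i$, $[\![\Delta]\!]=\prod A_i$ (product measurable space). A random expression $E$ of type $A$ over $\Gamma;\Delta$ gives for each $\gamma\in[\![\Gamma]\!]$ a measurable map $E(\gamma):[\![\Delta]\!]\to A$; a deterministic expression $e$ is a function $[\![\Gamma]\!]\to A$; a distribution $\mu'$ is a function $[\![\Gamma]\!]\to\mathcal GA$; a program $M$ gives for each $\gamma$ a measurable map $M(\gamma):[\![\Delta]\!]\to\mathcal GA$. PROPOSITIONS over $\Gamma;\Delta$: $\top,\bot,P\land Q,P\lor Q,P\to Q,P*Q,P\mathbin{-\!\!*}Q,\square P$; $\forall x{:}S.P$, $\exists x{:}S.P$ ($P$ over $\Gamma,x{:}S;\Delta$); $\forall_{\mathsf{rv}}X{:}A.P$, $\exists_{\mathsf{rv}}X{:}A.P$ ($P$ over $\Gamma;\Delta,X{:}A$); $E\sim\mu'$; $\mathsf{own}\,E$; $E_1\overset{\mathsf{as}}{=}E_2$; $\mathbb E[E]=e$ ($E,e$ of type $\mathbb R$); $\mathsf{wp}(M,X{:}A.Q)$ ($Q$ over $\Gamma;\Delta,X{:}A$); and $\mathsf C_{x:A\leftarrow E}P$ ($E$ a random expression of type $A$ over $\Gamma;\Delta$, $P$ over $\Gamma,x{:}A;\Delta$), where $A$ is assumed to have a countably generated $\sigma$-algebra containing all singletons. SATISFACTION by configurations $(\gamma,D,\mathcal P)$, $\gamma\in[\![\Gamma]\!]$, $D\in\mathrm{RV}[\![\Delta]\!]$, $\mathcal P\in\mathfrak M$ (all spaces $\mathcal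 P',\mathcal P_P,\mathcal P_Q,\mathcal P_f$ below range over $\mathfrak M$): $\top$ always; $\bot$ never; $\land,\lor$ pointwise; $P\to Q$ iff for all $\mathcal P'\sqsupseteq\mathcal P$, $\gamma,D,\mathcal P'\vDash P$ implies $\gamma,D,\mathcal P'\vDash Q$; $P*Q$ iff there are $\mathcal P_P\bullet\mathcal P_Q\sqsubseteq\mathcal P$ with $\gamma,D,\mathcal P_P\vDash P$ and $\gamma,D,\mathcal P_Q\vDash Q$; $P\mathbin{-\!\!*}Q$ iff for all $\mathcal P_P$ with $\mathcal P_P\bullet\mathcal P$ defined, $\gamma,D,\mathcal P_P\vDash P$ implies $\gamma,D,\mathcal P_P\bullet\mathcal P\vDash Q$; $\square P$ iff $\gamma,D,\mathbf 1\vDash P$; $\forall x{:}S.P$ (resp. $\exists$) iff $(\gamma,x),D,\mathcal P\vDash P$ for all (resp. some) $x\in S$; $\forall_{\mathsf{rv}}X{:}A.P$ (resp. $\exists_{\mathsf{rv}}$) iff $\gamma,(D,X),\mathcal P\vDash P$ for all (resp. some) $X\in\mathrm{RV}\,A$. With $\mathcal P=(\mathcal F,\mu)$: $\mathsf{own}\,E$ iff $E(\gamma)\circ D$ is $\mathcal F$-measurable; $E\sim\mu'$ iff moreover its law under $\mu$ is $\mu'(\gamma)$; $\mathbb E[E]=e$ iff $E(\gamma)\circ D$ is $\mathcal F$-measurable with $\mu$-expectation $e(\gamma)$; $E_1\overset{\mathsf{as}}{=}E_2$ iff, with $X_i=E_i(\gamma)\circ D$ and $F=\{\omega\mid X_1(\omega)=X_2(\omega)\}$,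 we have $F\in\mathcal F$, $\mu(F)=1$, and $F\cup(X_1,X_2)^{-1}(B)\in\mathcal F$ for every measurable $B$ in the product of the codomains. $\mathsf{wp}(M,X{:}A.Q)$ iff for all $\mathcal P_f$ and all probability measures $\mu$ on $\Sigma_\Omega$ with $\mathcal P_f\bullet\mathcal P\sqsubseteq(\Sigma_\Omega,\mu)$, and all contexts $\Delta_{ext}$ and $D_{ext}\in\mathrm{RV}[\![\Delta_{ext}]\!]$, there exist $X\in\mathrm{RV}\,A$, $\mathcal P'$ and a probability measure $\mu'$ on $\Sigma_\Omega$ with $\mathcal P_f\bullet\mathcal P'\sqsubseteq(\Sigma_\Omega,\mu')$ such that the law of $(D_{ext}(\omega),D(\omega),v)$ for $\omega\sim\mu$, $v\sim M(\gamma)(D(\omega))$ equals the law of $(D_{ext}(\omega),D(\omega),X(\omega))$ for $\omega\sim\mu'$, and $\gamma,(D,X),\mathcal P'\vDash Q$. $P\vdash Q$ means every configuration satisfying $P$ satisfies $Q$. DISINTEGRATION. A disintegration of a Borel probability measure $\mu'$ on $\Omega$ along a measurable $Y:\Omega\to A$ is a family $\{\nu_x\}_{x\in A}$ of probability measures on $\Sigma_\Omega$ such that $x\mapsto\int f\,d\nu_x$ is measurable for every measurable $f:\Omega\to\mathbb R_{\ge0}$, $\nu_x(\{Y=x\})=1$ for $Y_*\mu'$-almost all $x$, and $\int f\,d\mu'=\int_A\int_\Omega f\,d\nu_x\,dY_*\mu'(x)$ for every measurable $f:\Omega\to\mathbb R_{\ge0}$. Such disintegrations exist when the $\sigma$-algebra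 of $A$ is countably generated and contains all singletons. In the rules, $E$ (in C-Entail, C-Indep) and $X$ are random expressions of type $A$; in C-Subst, $x$ on the right denotes the constant random expression given by the deterministic variable $x$; in C-Total-Expectation, $E$ is a random expression of type $\mathbb R$ over $\Gamma;\Delta$, $v$ a deterministic real expression over $\Gamma$, $e$ a deterministic real expression over $\Gamma,x{:}A$ with $e(\gamma,\cdot)$ measurable for each $\gamma$ (so that $e[X/x]$ is a random expression), and $e[X/x]$ is the random expression $\gamma\mapsto(\delta\mapsto e(\gamma,X(\gamma)(\delta)))$.
   Formalization: C-Total-Expectation is proved for configurations where E has a possibly infinite expectation (positive and negative parts not both of infinite integral); it fails otherwise, e.g. E = 1 ± 2^N with a fair sign. In wp, external contexts use reals and the given value type, which is equivalent. *)

theory Defs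
  imports "HOL-Probability.Probability"
begin

section \<open>Resources\<close>

type_synonym sample = "nat \<Rightarrow> real"

text \<open>The Borel space $[0,1]^{\mathbb N}$; \<^const>\<open>borel\<close> on \<^typ>\<open>nat \<Rightarrow> real\<close> refers to the
  product topology.\<close>

definition Omega :: "sample measure" where
  "Omega = restrict_space borel {\<omega>. \<forall>i. \<omega> i \<in> {0..1}}"

text \<open>A probability space $(\mathcal F,\mu)$ with $\mathcal F \subseteq \Sigma_\Omega$ is one
  value of type \<^typ>\<open>sample measure\<close>, carrying both $\mathcal F$ (as \<^const>\<open>sets\<close>) and $\mu$.
  The probability measures on $\Sigma_\Omega$ are the elements of
  \<^term>\<open>space (prob_algebra Omega)\<close>.\<close>

definition extended_by :: "sample measure \<Rightarrow> sample measure \<Rightarrow> bool" (infix "\<sqsubseteq>\<^sub>r" 50) where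
  "P \<sqsubseteq>\<^sub>r Q \<longleftrightarrow> subalgebra Q P \<and> (\<forall>F\<in>sets P. emeasure P F = emeasure Q F)"

definition finite_footprint :: "sample measure \<Rightarrow> bool" where
  "finite_footprint P \<longleftrightarrow> (\<exists>n::nat. \<forall>F\<in>sets P. \<exists>F' \<subseteq> {..<n} \<rightarrow>\<^sub>E {0..1}.
     F = {\<omega> \<in> space Omega. restrict \<omega> {..<n} \<in> F'})"

definition countably_generated :: "'a measure \<Rightarrow> bool" where
  "countably_generated A \<longleftrightarrow>
     (\<exists>C. countable C \<and> C \<subseteq> Pow (space A) \<and> sets A = sigma_sets (space A) C)"

definition resources :: "sample measure set" where
  "resources = {P. prob_space P \<and> subalgebra Omega P \<and> countably_generated P \<and>
     finite_footprint P \<and> (\<exists>\<mu> \<in> space (prob_algebra Omega). P \<sqsubseteq>\<^sub>r \<mu>)}"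

text \<open>\<open>indep_comb P Q R\<close> says that $P \bullet Q$ is defined and equal to $R$. It is kept as a
  relation because $\bullet$ is partial; $R$ is determined by $P$ and $Q$, as the intersections
  $E \cap F$ form a generating $\pi$-system.\<close>

definition indep_comb :: "sample measure \<Rightarrow> sample measure \<Rightarrow> sample measure \<Rightarrow> bool" where
  "indep_comb P Q R \<longleftrightarrow> P \<in> resources \<and> Q \<in> resources \<and> R \<in> resources \<and>
     sets R = sigma_sets (space Omega) (sets P \<union> sets Q) \<and>
     (\<forall>E\<in>sets P. \<forall>F\<in>sets Q. emeasure R (E \<inter> F) = emeasure P E * emeasure Q F)"

definition unit_resource :: "sample measure" where
  "unit_resource = measure_of (space Omega) {{}, space Omega} (\<lambda>F. if F = {} then 0 else 1)"

definition RV :: "'a measure \<Rightarrow> (sample \<Rightarrow> 'a) set" where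
  "RV A = {X \<in> Omega \<rightarrow>\<^sub>M A. finite_footprint (vimage_algebra (space Omega) X A)}"


section \<open>Contexts and expressions\<close>

text \<open>All deterministic and random variables take values in one type \<open>'v\<close>; the sets and
  measurable spaces in contexts are sets and measurable spaces over \<open>'v\<close>. Real-valued expressions
  take values in \<^typ>\<open>real\<close> directly. Of a measurable space
  \<open>A :: 'v measure\<close> only \<^term>\<open>space A\<close> and \<^term>\<open>sets A\<close> matter.

  Variables are de Bruijn levels: the newest variable is the last one in the context.\<close>

definition det_env :: "'v set list \<Rightarrow> 'v list set" where
  "det_env \<Gamma> = {\<gamma>. list_all2 (\<in>) \<gamma> \<Gamma>}"

definition rv_ctx :: "'v measure list \<Rightarrow> (nat \<Rightarrow> 'v) measure" where
  "rv_ctx \<Delta> = PiM {..<length \<Delta>} (\<lambda>i. \<Delta> ! i)"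

text \<open>The extension $(D,X)$ of the random substitution $D$ for $\Delta$.\<close>

definition rv_extend ::
  "'v measure list \<Rightarrow> (sample \<Rightarrow> nat \<Rightarrow> 'v) \<Rightarrow> (sample \<Rightarrow> 'v) \<Rightarrow> sample \<Rightarrow> nat \<Rightarrow> 'v" where
  "rv_extend \<Delta> D X = (\<lambda>\<omega>. (D \<omega>)(length \<Delta> := X \<omega>))"

type_synonym ('v, 'a) rexp = "'v list \<Rightarrow> (nat \<Rightarrow> 'v) \<Rightarrow> 'a"

definition rand_expr ::
  "'v set list \<Rightarrow> 'v measure list \<Rightarrow> 'a measure \<Rightarrow> ('v, 'a) rexp \<Rightarrow> bool" where
  "rand_expr \<Gamma> \<Delta> A E \<longleftrightarrow> (\<forall>\<gamma>\<in>det_env \<Gamma>. E \<gamma> \<in> rv_ctx \<Delta> \<rightarrow>\<^sub>M A)"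

definition dist_expr :: "'v set list \<Rightarrow> 'v measure \<Rightarrow> ('v list \<Rightarrow> 'v measure) \<Rightarrow> bool" where
  "dist_expr \<Gamma> A m \<longleftrightarrow> (\<forall>\<gamma>\<in>det_env \<Gamma>. m \<gamma> \<in> space (prob_algebra A))"

definition conditionable :: "'v measure \<Rightarrow> bool" where
  "conditionable A \<longleftrightarrow> countably_generated A \<and> (\<forall>x\<in>space A. {x} \<in> sets A)"


section \<open>Propositions\<close>

datatype 'v assertion =
    PTrue
  | PFalse
  | PAnd "'v assertion" "'v assertion"
  | POr "'v assertion" "'v assertion"
  | PImp "'v assertion" "'v assertion"
  | Star "'v assertion" "'v assertion"
  | Wand "'v assertion" "'v assertion"
  | Box "'v assertion"
  | PAll "'v set" "'v assertion"
  | PEx "'v set" "'v assertion"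
  | AllRV "'v measure" "'v assertion"
  | ExRV "'v measure" "'v assertion"
  | Dist "'v measure" "('v, 'v) rexp" "'v list \<Rightarrow> 'v measure"
  | Own "'v measure" "('v, 'v) rexp"
  | AsEq "'v measure" "('v, 'v) rexp" "'v measure" "('v, 'v) rexp"
  | Expect "('v, real) rexp" "'v list \<Rightarrow> real"
  | WP "('v, 'v measure) rexp" "'v measure" "'v assertion"
  | Cond "'v measure" "('v, 'v) rexp" "'v assertion"

primrec wf_prop :: "'v assertion \<Rightarrow> 'v set list \<Rightarrow> 'v measure list \<Rightarrow> bool" where
  "wf_prop PTrue \<Gamma> \<Delta> \<longleftrightarrow> True"
| "wf_prop PFalse \<Gamma> \<Delta> \<longleftrightarrow> True"
| "wf_prop (PAnd P Q) \<Gamma> \<Delta> \<longleftrightarrow> wf_prop P \<Gamma> \<Delta> \<and> wf_prop Q \<Gamma> \<Delta>"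
| "wf_prop (POr P Q) \<Gamma> \<Delta> \<longleftrightarrow> wf_prop P \<Gamma> \<Delta> \<and> wf_prop Q \<Gamma> \<Delta>"
| "wf_prop (PImp P Q) \<Gamma> \<Delta> \<longleftrightarrow> wf_prop P \<Gamma> \<Delta> \<and> wf_prop Q \<Gamma> \<Delta>"
| "wf_prop (Star P Q) \<Gamma> \<Delta> \<longleftrightarrow> wf_prop P \<Gamma> \<Delta> \<and> wf_prop Q \<Gamma> \<Delta>"
| "wf_prop (Wand P Q) \<Gamma> \<Delta> \<longleftrightarrow> wf_prop P \<Gamma> \<Delta> \<and> wf_prop Q \<Gamma> \<Delta>"
| "wf_prop (Box P) \<Gamma> \<Delta> \<longleftrightarrow> wf_prop P \<Gamma> \<Delta>"
| "wf_prop (PAll S P) \<Gamma> \<Delta> \<longleftrightarrow> wf_prop P (\<Gamma> @ [S]) \<Delta>"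
| "wf_prop (PEx S P) \<Gamma> \<Delta> \<longleftrightarrow> wf_prop P (\<Gamma> @ [S]) \<Delta>"
| "wf_prop (AllRV A P) \<Gamma> \<Delta> \<longleftrightarrow> wf_prop P \<Gamma> (\<Delta> @ [A])"
| "wf_prop (ExRV A P) \<Gamma> \<Delta> \<longleftrightarrow> wf_prop P \<Gamma> (\<Delta> @ [A])"
| "wf_prop (Dist A E m) \<Gamma> \<Delta> \<longleftrightarrow> rand_expr \<Gamma> \<Delta> A E \<and> dist_expr \<Gamma> A m"
| "wf_prop (Own A E) \<Gamma> \<Delta> \<longleftrightarrow> rand_expr \<Gamma> \<Delta> A E"
| "wf_prop (AsEq A\<^sub>1 E\<^sub>1 A\<^sub>2 E\<^sub>2) \<Gamma> \<Delta> \<longleftrightarrow> rand_expr \<Gamma> \<Delta> A\<^sub>1 E\<^sub>1 \<and> rand_expr \<Gamma> \<Delta> A\<^sub>2 E\<^sub>2"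
| "wf_prop (Expect E e) \<Gamma> \<Delta> \<longleftrightarrow> rand_expr \<Gamma> \<Delta> borel E"
| "wf_prop (WP M A Q) \<Gamma> \<Delta> \<longleftrightarrow> rand_expr \<Gamma> \<Delta> (prob_algebra A) M \<and> wf_prop Q \<Gamma> (\<Delta> @ [A])"
| "wf_prop (Cond A E P) \<Gamma> \<Delta> \<longleftrightarrow>
     conditionable A \<and> rand_expr \<Gamma> \<Delta> A E \<and> wf_prop P (\<Gamma> @ [space A]) \<Delta>"


section \<open>Satisfaction\<close>

definition disintegration ::
  "sample measure \<Rightarrow> 'a measure \<Rightarrow> (sample \<Rightarrow> 'a) \<Rightarrow> ('a \<Rightarrow> sample measure) \<Rightarrow> bool" where
  "disintegration \<mu> A Y \<nu> \<longleftrightarrow>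
     (\<forall>x\<in>space A. \<nu> x \<in> space (prob_algebra Omega)) \<and>
     (\<forall>f\<in>borel_measurable Omega. (\<forall>\<omega>\<in>space Omega. (0::real) \<le> f \<omega>) \<longrightarrow>
        (\<lambda>x. \<integral>\<^sup>+\<omega>. ennreal (f \<omega>) \<partial>\<nu> x) \<in> borel_measurable A) \<and>
     (AE x in distr \<mu> A Y. emeasure (\<nu> x) {\<omega>\<in>space Omega. Y \<omega> = x} = 1) \<and>
     (\<forall>f\<in>borel_measurable Omega. (\<forall>\<omega>\<in>space Omega. (0::real) \<le> f \<omega>) \<longrightarrow>
        (\<integral>\<^sup>+\<omega>. ennreal (f \<omega>) \<partial>\<mu>) = (\<integral>\<^sup>+x. (\<integral>\<^sup>+\<omega>. ennreal (f \<omega>) \<partial>\<nu> x) \<partial>distr \<mu> A Y))"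

definition sat_as_eq ::
  "sample measure \<Rightarrow> 'a measure \<Rightarrow> (sample \<Rightarrow> 'a) \<Rightarrow> 'a measure \<Rightarrow> (sample \<Rightarrow> 'a) \<Rightarrow> bool" where
  "sat_as_eq P A\<^sub>1 X\<^sub>1 A\<^sub>2 X\<^sub>2 \<longleftrightarrow> (let F = {\<omega>\<in>space Omega. X\<^sub>1 \<omega> = X\<^sub>2 \<omega>} in
     F \<in> sets P \<and> emeasure P F = 1 \<and>
     (\<forall>B\<in>sets (A\<^sub>1 \<Otimes>\<^sub>M A\<^sub>2). F \<union> {\<omega>\<in>space Omega. (X\<^sub>1 \<omega>, X\<^sub>2 \<omega>) \<in> B} \<in> sets P))"

text \<open>\<open>sat P \<Delta> \<gamma> D \<P>\<close> is $\gamma, D, \mathcal P \vDash P$; the context $\Delta$ is needed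
  for the length of $D$ and for the laws in the weakest precondition.

  The external contexts of the weakest precondition range over measurable spaces on
  \<^typ>\<open>real + 'v\<close> rather than \<open>'v\<close>. This amounts to quantifying over all measurable spaces, however
  small \<open>'v\<close> is: a random variable of finite footprint factors through finitely many
  coordinates of the sample, so the contexts of real variables already decide the clause.\<close>

primrec sat :: "'v assertion \<Rightarrow> 'v measure list \<Rightarrow> 'v list \<Rightarrow> (sample \<Rightarrow> nat \<Rightarrow> 'v) \<Rightarrow>
    sample measure \<Rightarrow> bool" where
  "sat PTrue \<Delta> \<gamma> D \<P> \<longleftrightarrow> True"
| "sat PFalse \<Delta> \<gamma> D \<P> \<longleftrightarrow> False"
| "sat (PAnd P Q) \<Delta> \<gamma> D \<P> \<longleftrightarrow> sat P \<Delta> \<gamma> D \<P> \<and> sat Q \<Delta> \<gamma> D \<P>"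
| "sat (POr P Q) \<Delta> \<gamma> D \<P> \<longleftrightarrow> sat P \<Delta> \<gamma> D \<P> \<or> sat Q \<Delta> \<gamma> D \<P>"
| "sat (PImp P Q) \<Delta> \<gamma> D \<P> \<longleftrightarrow>
     (\<forall>\<P>'\<in>resources. \<P> \<sqsubseteq>\<^sub>r \<P>' \<longrightarrow> sat P \<Delta> \<gamma> D \<P>' \<longrightarrow> sat Q \<Delta> \<gamma> D \<P>')"
| "sat (Star P Q) \<Delta> \<gamma> D \<P> \<longleftrightarrow>
     (\<exists>\<P>\<^sub>P\<in>resources. \<exists>\<P>\<^sub>Q\<in>resources. \<exists>\<R>. indep_comb \<P>\<^sub>P \<P>\<^sub>Q \<R> \<and> \<R> \<sqsubseteq>\<^sub>r \<P> \<and>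
        sat P \<Delta> \<gamma> D \<P>\<^sub>P \<and> sat Q \<Delta> \<gamma> D \<P>\<^sub>Q)"
| "sat (Wand P Q) \<Delta> \<gamma> D \<P> \<longleftrightarrow>
     (\<forall>\<P>\<^sub>P\<in>resources. \<forall>\<R>. indep_comb \<P>\<^sub>P \<P> \<R> \<longrightarrow> sat P \<Delta> \<gamma> D \<P>\<^sub>P \<longrightarrow> sat Q \<Delta> \<gamma> D \<R>)"
| "sat (Box P) \<Delta> \<gamma> D \<P> \<longleftrightarrow> sat P \<Delta> \<gamma> D unit_resource"
| "sat (PAll S P) \<Delta> \<gamma> D \<P> \<longleftrightarrow> (\<forall>x\<in>S. sat P \<Delta> (\<gamma> @ [x]) D \<P>)"
| "sat (PEx S P) \<Delta> \<gamma> D \<P> \<longleftrightarrow> (\<exists>x\<in>S. sat P \<Delta> (\<gamma> @ [x]) D \<P>)"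
| "sat (AllRV A P) \<Delta> \<gamma> D \<P> \<longleftrightarrow> (\<forall>X\<in>RV A. sat P (\<Delta> @ [A]) \<gamma> (rv_extend \<Delta> D X) \<P>)"
| "sat (ExRV A P) \<Delta> \<gamma> D \<P> \<longleftrightarrow> (\<exists>X\<in>RV A. sat P (\<Delta> @ [A]) \<gamma> (rv_extend \<Delta> D X) \<P>)"
| "sat (Dist A E m) \<Delta> \<gamma> D \<P> \<longleftrightarrow> E \<gamma> \<circ> D \<in> \<P> \<rightarrow>\<^sub>M A \<and> distr \<P> A (E \<gamma> \<circ> D) = m \<gamma>"
| "sat (Own A E) \<Delta> \<gamma> D \<P> \<longleftrightarrow> E \<gamma> \<circ> D \<in> \<P> \<rightarrow>\<^sub>M A"
| "sat (AsEq A\<^sub>1 E\<^sub>1 A\<^sub>2 E\<^sub>2) \<Delta> \<gamma> D \<P> \<longleftrightarrow> sat_as_eq \<P> A\<^sub>1 (E\<^sub>1 \<gamma> \<circ> D) A\<^sub>2 (E\<^sub>2 \<gamma> \<circ> D)"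
| "sat (Expect E e) \<Delta> \<gamma> D \<P> \<longleftrightarrow>
     E \<gamma> \<circ> D \<in> borel_measurable \<P> \<and> has_bochner_integral \<P> (E \<gamma> \<circ> D) (e \<gamma>)"
| "sat (WP M A Q) \<Delta> \<gamma> D \<P> \<longleftrightarrow>
     (\<forall>\<P>\<^sub>f\<in>resources. \<forall>\<mu>\<in>space (prob_algebra Omega). \<forall>\<R>.
        indep_comb \<P>\<^sub>f \<P> \<R> \<longrightarrow> \<R> \<sqsubseteq>\<^sub>r \<mu> \<longrightarrow>
        (\<forall>\<Delta>\<^sub>e :: (real + 'v) measure list. \<forall>D\<^sub>e\<in>RV (rv_ctx \<Delta>\<^sub>e).
           \<exists>X\<in>RV A. \<exists>\<P>'\<in>resources. \<exists>\<mu>'\<in>space (prob_algebra Omega). \<exists>\<R>'.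
             indep_comb \<P>\<^sub>f \<P>' \<R>' \<and> \<R>' \<sqsubseteq>\<^sub>r \<mu>' \<and>
             (let N = rv_ctx \<Delta>\<^sub>e \<Otimes>\<^sub>M (rv_ctx \<Delta> \<Otimes>\<^sub>M A) in
                bind \<mu> (\<lambda>\<omega>. bind (M \<gamma> (D \<omega>)) (\<lambda>v. return N (D\<^sub>e \<omega>, D \<omega>, v)))
                = distr \<mu>' N (\<lambda>\<omega>. (D\<^sub>e \<omega>, D \<omega>, X \<omega>))) \<and>
             sat Q (\<Delta> @ [A]) \<gamma> (rv_extend \<Delta> D X) \<P>'))"
| "sat (Cond A E P) \<Delta> \<gamma> D \<P> \<longleftrightarrow>
     (\<forall>\<mu>\<in>space (prob_algebra Omega). \<P> \<sqsubseteq>\<^sub>r \<mu> \<longrightarrow>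
        (\<forall>\<nu>. disintegration \<mu> A (E \<gamma> \<circ> D) \<nu> \<longrightarrow>
           (AE x in distr \<mu> A (E \<gamma> \<circ> D). sat P \<Delta> (\<gamma> @ [x]) D (restr_to_subalg (\<nu> x) \<P>))))"

definition entails ::
  "'v set list \<Rightarrow> 'v measure list \<Rightarrow> 'v assertion \<Rightarrow> 'v assertion \<Rightarrow> bool" where
  "entails \<Gamma> \<Delta> P Q \<longleftrightarrow> (\<forall>\<gamma>\<in>det_env \<Gamma>. \<forall>D\<in>RV (rv_ctx \<Delta>). \<forall>\<P>\<in>resources.
     sat P \<Delta> \<gamma> D \<P> \<longrightarrow> sat Q \<Delta> \<gamma> D \<P>)"


section \<open>Weakening\<close>

text \<open>A proposition or expression over $\Gamma$ is read over $\Gamma, x{:}S$ by ignoring the entry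
  at level \<open>n = length \<Gamma>\<close>. Variables bound inside the proposition have levels
  above \<open>n\<close>, so \<open>n\<close> does not change under binders.\<close>

definition drop_var :: "nat \<Rightarrow> 'v list \<Rightarrow> 'v list" where
  "drop_var n \<gamma> = take n \<gamma> @ drop (Suc n) \<gamma>"

primrec weaken :: "nat \<Rightarrow> 'v assertion \<Rightarrow> 'v assertion" where
  "weaken n PTrue = PTrue"
| "weaken n PFalse = PFalse"
| "weaken n (PAnd P Q) = PAnd (weaken n P) (weaken n Q)"
| "weaken n (POr P Q) = POr (weaken n P) (weaken n Q)"
| "weaken n (PImp P Q) = PImp (weaken n P) (weaken n Q)"
| "weaken n (Star P Q) = Star (weaken n P) (weaken n Q)"
| "weaken n (Wand P Q) = Wand (weaken n P) (weaken n Q)"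
| "weaken n (Box P) = Box (weaken n P)"
| "weaken n (PAll S P) = PAll S (weaken n P)"
| "weaken n (PEx S P) = PEx S (weaken n P)"
| "weaken n (AllRV A P) = AllRV A (weaken n P)"
| "weaken n (ExRV A P) = ExRV A (weaken n P)"
| "weaken n (Dist A E m) = Dist A (E \<circ> drop_var n) (m \<circ> drop_var n)"
| "weaken n (Own A E) = Own A (E \<circ> drop_var n)"
| "weaken n (AsEq A\<^sub>1 E\<^sub>1 A\<^sub>2 E\<^sub>2) = AsEq A\<^sub>1 (E\<^sub>1 \<circ> drop_var n) A\<^sub>2 (E\<^sub>2 \<circ> drop_var n)"
| "weaken n (Expect E e) = Expect (E \<circ> drop_var n) (e \<circ> drop_var n)"
| "weaken n (WP M A Q) = WP (M \<circ> drop_var n) A (weaken n Q)"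
| "weaken n (Cond A E P) = Cond A (E \<circ> drop_var n) (weaken n P)"

lemma sat_weaken:
  "n < length \<gamma> \<Longrightarrow> sat (weaken n P) \<Delta> \<gamma> D \<P> \<longleftrightarrow> sat P \<Delta> (drop_var n \<gamma>) D \<P>"
proof (induction P arbitrary: \<Delta> \<gamma> D \<P>)
  case (PAll S P)
  then show ?case by (simp add: drop_var_def)
next
  case (PEx S P)
  then show ?case by (simp add: drop_var_def)
next
  case (Cond A E P)
  then show ?case by (simp add: drop_var_def o_def)
qed simp_all

text \<open>The possibly infinite expectation of $X$ exists, that is, its positive and negative parts do
  not both have infinite integral. The law of total expectation needs this: conditional means of
  $X$ may exist and be integrable while $X$ has no expectation. For example, if $N = n$ with
  probability $2^{-n}$ and $X = 1 \pm 2^N$ with a fair independent sign, then the conditional means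
  given $N$ all equal $1$.\<close>

definition expectation_exists :: "'a measure \<Rightarrow> ('a \<Rightarrow> real) \<Rightarrow> bool" where
  "expectation_exists M X \<longleftrightarrow>
     (\<integral>\<^sup>+\<omega>. ennreal (X \<omega>) \<partial>M) < \<infinity> \<or> (\<integral>\<^sup>+\<omega>. ennreal (- X \<omega>) \<partial>M) < \<infinity>"

end

theory Submission
  imports Defs
begin

text \<open>Satisfaction is monotone in the resource, and weakening is semantic, so C-Indep reduces to
  the following: if $\mathcal P_E$ and $\mathcal P_P$ are independent under $\mu$ and $Y$ is measurable in
  $\mathcal P_E$, then $\nu_x(F) = \mu(F)$ for almost all $x$, for each event $F$ of $\mathcal P_P$. As
  $\mathcal P_P$ is countably generated, almost every $\nu_x$ restricts to $\mathcal P_P$ itself.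
  C-Entail and C-Subst are direct. C-Total-Expectation is the only rule that needs some disintegration
  to exist: $\Omega$ is coded measurably and invertibly into the reals, where the conditional law is
  built from a version of the conditional distribution function.\<close>

section \<open>Coding samples by real numbers\<close>

text \<open>The conditioning clause quantifies universally over extensions \<mu> and disintegrations
  \<nu>. A conclusion of that form only uses properties of a given \<nu>, whereas an expectation
  under the resource itself does not mention \<nu> and can be drawn from the clause only if some
  \<nu> exists. The recurring obstacle is that each almost sure identity comes with its own null
  set, so only countably many can be imposed at once: rational thresholds for distribution
  functions, a countable separating family for the fibres, a countable \<pi>-system for the
  restricted laws. This is also the reason for the detour through the reals, where a measure can be
  rebuilt from its distribution function at rational points. Independence fixes
  \<open>\<nu> x\<close> only on the independent part, while the clause evaluates the proposition on
  the whole resource; monotonicity bridges this gap.\<close>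

text \<open>Base 3 with digits 0 and 1 makes digit extraction unconditional: the tail after any digit is at
  most $1/2 < 1$, so no expansion is ambiguous.\<close>

definition ternary :: "(nat \<Rightarrow> bool) \<Rightarrow> real" where
  "ternary b = (\<Sum>k. of_bool (b k) / 3 ^ k)"

lemma summable_ternary: "summable (\<lambda>k. of_bool (b k) / 3 ^ k :: real)"
proof (rule summable_comparison_test'[of "\<lambda>k. (1/3::real) ^ k"])
  show "summable (\<lambda>k. (1/3::real) ^ k)"
    by (rule summable_geometric) simp
qed (simp add: power_divide)

text \<open>The constant 3/2 is the geometric sum with ratio 1/3; after the division by 3 in
  \<open>ternary_head\<close> it becomes the 1/2 that keeps the floor exact.\<close>

lemma ternary_bounds: "0 \<le> ternary b" "ternary b \<le> 3/2"
proof -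
  show "0 \<le> ternary b"
    unfolding ternary_def by (rule suminf_nonneg[OF summable_ternary]) simp
  have "ternary b \<le> (\<Sum>k. (1/3::real) ^ k)"
    unfolding ternary_def
    by (rule suminf_le[OF _ summable_ternary summable_geometric]) (simp_all add: power_divide)
  also have "\<dots> = 3/2"
    by (subst suminf_geometric) auto
  finally show "ternary b \<le> 3/2" .
qed

lemma ternary_head: "ternary b = of_bool (b 0) + ternary (\<lambda>k. b (Suc k)) / 3"
proof -
  have "(\<Sum>k. of_bool (b (Suc k)) / 3 ^ Suc k) = ternary (\<lambda>k. b (Suc k)) / (3::real)"
    unfolding ternary_def
    using suminf_divide[OF summable_ternary[of "\<lambda>k. b (Suc k)"], of 3]
    by (simp add: field_simps)
  then show ?thesis
    using suminf_split_head[OF summable_ternary[of b]] by (simp add: ternary_def)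
qed

text \<open>Multiplying by \<open>3 ^ k\<close> turns the digits before position \<open>k\<close>
  into multiples of 3 and makes digit \<open>k\<close> the units digit, with a tail below 1. The
  induction peels off the head, whose contribution vanishes modulo 3.\<close>

lemma ternary_digit: "\<lfloor>3 ^ k * ternary b\<rfloor> mod 3 = of_bool (b k)"
proof (induction k arbitrary: b)
  case 0
  have "\<lfloor>ternary b\<rfloor> = of_bool (b 0)"
    using ternary_head[of b] ternary_bounds[of "\<lambda>k. b (Suc k)"]
    by (intro floor_unique) (auto simp: of_bool_def)
  then show ?case by simp
next
  case (Suc k)
  have "3 ^ Suc k * ternary b =
      3 ^ k * ternary (\<lambda>k. b (Suc k)) + of_int (3 * (3 ^ k * of_bool (b 0)))"
    by (subst ternary_head) (simp add: algebra_simps)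
  then have "\<lfloor>3 ^ Suc k * ternary b\<rfloor> =
      \<lfloor>3 ^ k * ternary (\<lambda>k. b (Suc k))\<rfloor> + 3 * (3 ^ k * of_bool (b 0))"
    by (simp only: floor_add_int)
  then show ?case
    using Suc[of "\<lambda>k. b (Suc k)"] by simp
qed

section \<open>Samples as bit sequences of rational comparisons\<close>

lemma space_Omega: "space Omega = {\<omega>. \<forall>i. \<omega> i \<in> {0..1}}"
  by (simp add: Omega_def space_restrict_space)

lemma measurable_Omega_component [measurable]: "(\<lambda>\<omega>. \<omega> i) \<in> borel_measurable Omega"
  unfolding Omega_def by (intro measurable_restrict_space1) measurable

text \<open>A sample is coded by the bits $[q < \omega_i]$ for rational $q$; decoding recovers $\omega_i$ as
  the supremum of these $q$, clipped to $[0,1]$ so that every real decodes to a point of $\Omega$.\<close>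

definition encode :: "sample \<Rightarrow> real" where
  "encode \<omega> = ternary (\<lambda>k. case from_nat k of (i, q::rat) \<Rightarrow> of_rat q < \<omega> i)"

definition decode :: "real \<Rightarrow> sample" where
  "decode z i = (SUP q::rat. if \<lfloor>3 ^ to_nat (i, q) * z\<rfloor> mod 3 = 1 then max 0 (min 1 (of_rat q)) else 0)"

lemma measurable_encode [measurable]: "encode \<in> borel_measurable Omega"
  unfolding encode_def[abs_def] ternary_def by measurable

lemma decode_bdd:
  "bdd_above (range (\<lambda>q::rat. if P q then max 0 (min 1 (of_rat q)) else (0::real)))"
  by (intro bdd_aboveI[of _ 1]) auto

lemma measurable_decode [measurable]: "decode \<in> borel \<rightarrow>\<^sub>M Omega"
  unfolding Omega_def
proof (rule measurable_restrict_space2)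
  have "0 \<le> decode z i" for z i
    unfolding decode_def by (rule cSUP_upper2[OF decode_bdd]) auto
  moreover have "decode z i \<le> 1" for z i
    unfolding decode_def by (rule cSUP_least) auto
  ultimately show "decode \<in> space borel \<rightarrow> {\<omega>. \<forall>i. \<omega> i \<in> {0..1}}"
    by simp
  show "decode \<in> borel_measurable borel"
    by (rule measurable_coordinatewise_then_product, unfold decode_def,
        rule borel_measurable_cSUP[OF _ _ decode_bdd]) measurable
qed

lemma decode_encode:
  assumes "\<omega> \<in> space Omega"
  shows "decode (encode \<omega>) = \<omega>"
proof
  fix i
  have digit: "\<lfloor>3 ^ to_nat (i, q) * encode \<omega>\<rfloor> mod 3 = 1 \<longleftrightarrow> of_rat q < \<omega> i" for q :: rat
    unfolding encode_def by (simp add: ternary_digit)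
  have \<omega>: "0 \<le> \<omega> i" "\<omega> i \<le> 1"
    using assms by (auto simp: space_Omega)
  have "decode (encode \<omega>) i = (SUP q::rat. if of_rat q < \<omega> i then max 0 (min 1 (of_rat q)) else 0)"
    unfolding decode_def digit ..
  also have "\<dots> = \<omega> i"
  proof (rule cSup_eq_non_empty)
    fix y :: real assume "\<And>x. x \<in> range (\<lambda>q::rat. if of_rat q < \<omega> i then max 0 (min 1 (of_rat q)) else 0) \<Longrightarrow> x \<le> y"
    then have y: "(if of_rat q < \<omega> i then max 0 (min 1 (of_rat q)) else 0) \<le> y" for q :: rat
      by blast
    show "\<omega> i \<le> y"
    proof (rule ccontr)
      assume "\<not> \<omega> i \<le> y"
      \<comment> \<open>Clipping below at 0 can only raise the value, and clipping above at 1 has no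
        effect since \<open>of_rat q < \<omega> i \<le> 1\<close>; so the clipped \<open>q\<close>
        still exceeds \<open>y\<close>.\<close>
      then obtain q where "y < of_rat q" "of_rat q < \<omega> i"
        using of_rat_dense[of y "\<omega> i"] by auto
      with y[of q] \<omega> show False by (auto split: if_splits)
    qed
  qed (use \<omega> in auto)
  finally show "decode (encode \<omega>) i = \<omega> i" .
qed

text \<open>Boundedness of the code lets conditional distribution functions be set to exactly 0 and
  1 outside a fixed interval, so no mass escapes to infinity.\<close>

lemma encode_bounds: "0 \<le> encode \<omega>" "encode \<omega> \<le> 3/2"
  unfolding encode_def by (rule ternary_bounds)+


section \<open>Regular conditional distributions\<close>

text \<open>\<open>g\<close> is a version of the conditional probability of \<open>C\<close> given
  \<open>Y = x\<close>: a null set of the law of \<open>Y\<close> has a null preimage, so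
  Radon-Nikodym applies. Writing the measure on \<open>A\<close> as the image of a density supplies
  countable additivity.\<close>

lemma cond_prob_exists:
  assumes "prob_space \<mu>" and Y [measurable]: "Y \<in> \<mu> \<rightarrow>\<^sub>M A" and C [measurable]: "C \<in> sets \<mu>"
  shows "\<exists>g\<in>borel_measurable A. \<forall>B\<in>sets A.
    (\<integral>\<^sup>+x. g x * indicator B x \<partial>distr \<mu> A Y) = emeasure \<mu> (Y -` B \<inter> C)"
proof -
  interpret prob_space \<mu> by fact
  interpret law: prob_space "distr \<mu> A Y" by (rule prob_space_distr) fact
  let ?N = "distr (density \<mu> (indicator C)) A Y"
  have N: "emeasure ?N B = emeasure \<mu> (Y -` B \<inter> C)" if [measurable]: "B \<in> sets A" for B
  proof -
    have "emeasure ?N B = (\<integral>\<^sup>+\<omega>. indicator C \<omega> * indicator (Y -` B \<inter> space \<mu>) \<omega> \<partial>\<mu>)"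
      by (subst emeasure_distr) (auto simp: emeasure_density)
    also have "\<dots> = (\<integral>\<^sup>+\<omega>. indicator (Y -` B \<inter> space \<mu> \<inter> C) \<omega> \<partial>\<mu>)"
      by (intro nn_integral_cong) (auto simp: indicator_def)
    also have "\<dots> = emeasure \<mu> (Y -` B \<inter> space \<mu> \<inter> C)"
      by (rule nn_integral_indicator) measurable
    also have "Y -` B \<inter> space \<mu> \<inter> C = Y -` B \<inter> C"
      using sets.sets_into_space[OF C] by auto
    finally show ?thesis .
  qed
  have ac: "absolutely_continuous (distr \<mu> A Y) ?N"
    unfolding absolutely_continuous_def
  proof
    fix B assume B: "B \<in> null_sets (distr \<mu> A Y)"
    then have [measurable]: "B \<in> sets A" by auto
    have "emeasure \<mu> (Y -` B \<inter> C) \<le> emeasure \<mu> (Y -` B \<inter> space \<mu>)"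
      using sets.sets_into_space[OF C] by (intro emeasure_mono) auto
    also have "\<dots> = 0"
      using B by (auto simp: null_sets_def emeasure_distr)
    finally show "B \<in> null_sets ?N"
      by (auto simp: null_sets_def N)
  qed
  show ?thesis
  proof (intro bexI[of _ "RN_deriv (distr \<mu> A Y) ?N"] ballI)
    fix B assume [measurable]: "B \<in> sets A"
    show "(\<integral>\<^sup>+x. RN_deriv (distr \<mu> A Y) ?N x * indicator B x \<partial>distr \<mu> A Y) = emeasure \<mu> (Y -` B \<inter> C)"
      by (simp add: emeasure_density[symmetric] law.density_RN_deriv[OF ac] N)
  qed (metis borel_measurable_RN_deriv measurable_distr_eq1)
qed

text \<open>Versions of the conditional probability of \<open>Z \<le> q\<close> given
  \<open>Y = x\<close>, for rational \<open>q\<close>, are regularised into distribution functions,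
  and the Stieltjes measures of these form the kernel. The bounds on \<open>Z\<close> settle the
  limits at both infinities for every \<open>x\<close>.\<close>

lemma regular_conditional_distribution:
  fixes Z :: "'a \<Rightarrow> real"
  assumes "prob_space \<mu>" and Y [measurable]: "Y \<in> \<mu> \<rightarrow>\<^sub>M A"
    and Z [measurable]: "Z \<in> borel_measurable \<mu>"
    and bounds: "\<And>\<omega>. \<omega> \<in> space \<mu> \<Longrightarrow> a \<le> Z \<omega>" "\<And>\<omega>. \<omega> \<in> space \<mu> \<Longrightarrow> Z \<omega> \<le> b"
  shows "\<exists>\<kappa>\<in>A \<rightarrow>\<^sub>M prob_algebra borel. \<forall>B\<in>sets A. \<forall>C\<in>sets borel.
    (\<integral>\<^sup>+x. emeasure (\<kappa> x) C * indicator B x \<partial>distr \<mu> A Y) = emeasure \<mu> (Y -` B \<inter> Z -` C \<inter> space \<mu>)"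
proof -
  interpret prob_space \<mu> by fact
  interpret law: prob_space "distr \<mu> A Y" by (rule prob_space_distr) fact
  let ?L = "distr \<mu> A Y"
  have uniq: "AE x in ?L. f x = g x" if "f \<in> borel_measurable A" "g \<in> borel_measurable A"
    "\<And>B. B \<in> sets A \<Longrightarrow> (\<integral>\<^sup>+x. f x * indicator B x \<partial>?L) = (\<integral>\<^sup>+x. g x * indicator B x \<partial>?L)" for f g
    using that by (intro law.density_unique_finite_measure) auto
  have Z_sets: "{\<omega>\<in>space \<mu>. Z \<omega> \<in> I} \<in> sets \<mu>" if "I \<in> sets borel" for I
    using that by measurable
  \<comment> \<open>Versions are taken for all Borel sets and not only for half-lines: the one for
    \<open>{r<..s}\<close> serves as the increment from \<open>p r\<close> to \<open>p s\<close>,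
    which gives monotonicity without subtracting extended reals.\<close>
  have "\<forall>I\<in>sets borel. \<exists>p. p \<in> borel_measurable A \<and> (\<forall>B\<in>sets A.
      (\<integral>\<^sup>+x. p x * indicator B x \<partial>?L) = emeasure \<mu> (Y -` B \<inter> {\<omega>\<in>space \<mu>. Z \<omega> \<in> I}))"
    using cond_prob_exists[OF \<open>prob_space \<mu>\<close> Y Z_sets] by blast
  from bchoice[OF this] obtain p' where
    "\<forall>I\<in>sets borel. p' I \<in> borel_measurable A \<and> (\<forall>B\<in>sets A.
      (\<integral>\<^sup>+x. p' I x * indicator B x \<partial>?L) = emeasure \<mu> (Y -` B \<inter> {\<omega>\<in>space \<mu>. Z \<omega> \<in> I}))" ..
  then have p': "p' I \<in> borel_measurable A"
    and int_p': "B \<in> sets A \<Longrightarrow>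
      (\<integral>\<^sup>+x. p' I x * indicator B x \<partial>?L) = emeasure \<mu> (Y -` B \<inter> {\<omega>\<in>space \<mu>. Z \<omega> \<in> I})"
    if "I \<in> sets borel" for I B
    using that by blast+
  define p where "p r = p' {..r}" for r
  have p [measurable]: "p r \<in> borel_measurable A" for r
    unfolding p_def by (rule p') simp
  have int_p: "(\<integral>\<^sup>+x. p r x * indicator B x \<partial>?L) = emeasure \<mu> (Y -` B \<inter> {\<omega>\<in>space \<mu>. Z \<omega> \<le> r})"
    if "B \<in> sets A" for r B
    using int_p'[of "{..r}", OF _ that] by (simp add: p_def)
  have p_mono: "AE x in ?L. p r x \<le> p s x" if "r \<le> s" for r s
  proof -
    have [measurable]: "p' {r<..s} \<in> borel_measurable A"
      by (rule p') simp
    have "AE x in ?L. p r x + p' {r<..s} x = p s x"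
    proof (rule uniq)
      fix B assume B [measurable]: "B \<in> sets A"
      have "(\<integral>\<^sup>+x. (p r x + p' {r<..s} x) * indicator B x \<partial>?L) =
          (\<integral>\<^sup>+x. p r x * indicator B x \<partial>?L) + (\<integral>\<^sup>+x. p' {r<..s} x * indicator B x \<partial>?L)"
        by (simp add: distrib_right nn_integral_add)
      also have "\<dots> = emeasure \<mu> (Y -` B \<inter> {\<omega>\<in>space \<mu>. Z \<omega> \<le> r}) + emeasure \<mu> (Y -` B \<inter> {\<omega>\<in>space \<mu>. Z \<omega> \<in> {r<..s}})"
        using B by (subst (1) int_p, simp, subst int_p', simp_all)
      also have "\<dots> = emeasure \<mu> (Y -` B \<inter> {\<omega>\<in>space \<mu>. Z \<omega> \<le> r} \<union> Y -` B \<inter> {\<omega>\<in>space \<mu>. Z \<omega> \<in> {r<..s}})"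
      proof (rule plus_emeasure)
        have "Y -` B \<inter> {\<omega>\<in>space \<mu>. Z \<omega> \<le> r} = {\<omega>\<in>space \<mu>. Y \<omega> \<in> B \<and> Z \<omega> \<le> r}"
          "Y -` B \<inter> {\<omega>\<in>space \<mu>. Z \<omega> \<in> {r<..s}} = {\<omega>\<in>space \<mu>. Y \<omega> \<in> B \<and> Z \<omega> \<in> {r<..s}}"
          by auto
        then show "Y -` B \<inter> {\<omega>\<in>space \<mu>. Z \<omega> \<le> r} \<in> sets \<mu>"
          "Y -` B \<inter> {\<omega>\<in>space \<mu>. Z \<omega> \<in> {r<..s}} \<in> sets \<mu>"
          by (simp_all only:) measurable
      qed auto
      also have "Y -` B \<inter> {\<omega>\<in>space \<mu>. Z \<omega> \<le> r} \<union> Y -` B \<inter> {\<omega>\<in>space \<mu>. Z \<omega> \<in> {r<..s}} = Y -` B \<inter> {\<omega>\<in>space \<mu>. Z \<omega> \<le> s}"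
        using that by auto
      finally show "(\<integral>\<^sup>+x. (p r x + p' {r<..s} x) * indicator B x \<partial>?L) = (\<integral>\<^sup>+x. p s x * indicator B x \<partial>?L)"
        by (simp add: int_p)
    qed measurable
    then show ?thesis
      by eventually_elim (metis le_iff_add)
  qed
  have p_0: "AE x in ?L. p r x = 0" if "r < a" for r
  proof (rule uniq)
    fix B assume "B \<in> sets A"
    have "{\<omega>\<in>space \<mu>. Z \<omega> \<le> r} = {}"
      using bounds(1) that by force
    then show "(\<integral>\<^sup>+x. p r x * indicator B x \<partial>?L) = (\<integral>\<^sup>+x. 0 * indicator B x \<partial>?L)"
      by (simp only: int_p[OF \<open>B \<in> sets A\<close>]) simp
  qed measurable
  have p_1: "AE x in ?L. p r x = 1" if "b \<le> r" for r
  proof (rule uniq)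
    fix B assume [measurable]: "B \<in> sets A"
    have "{\<omega>\<in>space \<mu>. Z \<omega> \<le> r} = space \<mu>"
      using bounds(2) that by force
    then show "(\<integral>\<^sup>+x. p r x * indicator B x \<partial>?L) = (\<integral>\<^sup>+x. 1 * indicator B x \<partial>?L)"
      by (simp only: int_p[OF \<open>B \<in> sets A\<close>]) (simp add: emeasure_distr)
  qed measurable

  txt \<open>Clipping and taking suprema changes \<open>p\<close> only on a null set but makes \<open>F x\<close> below a
    distribution function for every \<open>x\<close>, so no exceptional set has to be carved out.\<close>
  define G where "G x q = (if of_rat q < a then 0 else if b \<le> of_rat q then 1
    else min 1 (enn2real (SUP s\<in>{..q}. min 1 (p (of_rat s) x))))" for x and q :: rat
  have G_meas [measurable]: "(\<lambda>x. G x q) \<in> borel_measurable A" for q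
    unfolding G_def by measurable
  have SUP_le: "(SUP s\<in>{..q}. min 1 (p (of_rat s) x)) \<le> 1" for q :: rat and x
    by (rule SUP_least) simp
  have G_01: "0 \<le> G x q" "G x q \<le> 1" for x q
    by (auto simp: G_def)
  have ab: "a \<le> b"
    using bounds not_empty by force
  have G_mono: "G x q \<le> G x r" if "q \<le> r" for x q r
  proof -
    \<comment> \<open>\<open>enn2real\<close> sends infinity to 0, so it is monotone only below a
      finite bound; the cap by 1 inside the supremum provides one.\<close>
    have "(SUP s\<in>{..r}. min 1 (p (of_rat s) x)) < top"
      using SUP_le by (rule le_less_trans) simp
    then have "enn2real (SUP s\<in>{..q}. min 1 (p (of_rat s) x)) \<le> enn2real (SUP s\<in>{..r}. min 1 (p (of_rat s) x))"
      using that by (intro enn2real_mono SUP_subset_mono) auto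
    then show ?thesis
      using that ab of_rat_less_eq[of q r, where 'a = real]
      by (auto simp: G_def min_def simp del: of_rat_less_eq)
  qed
  \<comment> \<open>The infimum runs over rationals strictly above \<open>r\<close>, which makes
    \<open>F x\<close> right-continuous although \<open>G x\<close> need not be.\<close>
  define F where "F x r = (INF q\<in>{q. r < of_rat q}. G x q)" for x and r :: real
  have rat_above: "\<exists>q. r < of_rat q" for r :: real
    using of_rat_dense[of r "r + 1"] by auto
  have bdd: "bdd_below (G x ` I)" for x I
    by (rule bdd_belowI[of _ 0]) (auto simp: G_01)
  have F_le: "F x r \<le> G x q" if "r < of_rat q" for x r q
    unfolding F_def using that by (intro cINF_lower bdd) auto
  have F_ge: "c \<le> F x r" if "\<And>q. r < of_rat q \<Longrightarrow> c \<le> G x q" for x r c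
    unfolding F_def using that rat_above[of r] by (intro cINF_greatest) auto
  have F_mono: "F x r \<le> F x s" if "r \<le> s" for x r s
    using that by (intro F_ge F_le) auto
  have F_01: "0 \<le> F x r" "F x r \<le> 1" for x r
    using F_ge[of r 0 x] G_01 F_le[of r _ x] rat_above[of r] order_trans by (blast, meson)
  have F_right: "continuous (at_right r) (F x)" for x r
  proof -
    \<comment> \<open>A rational \<open>q\<close> nearly attaining the infimum bounds
      \<open>F x\<close> at the midpoint of \<open>r\<close> and \<open>q\<close>, which lies
      strictly below \<open>q\<close>.\<close>
    have "\<exists>d>0. F x (r + d) - F x r < e" if "0 < e" for e
    proof -
      obtain q where "r < of_rat q" "G x q < F x r + e"
        using F_ge[of r "F x r + e" x] \<open>0 < e\<close> by (meson not_le less_add_same_cancel1)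
      then show ?thesis
        using F_le[of "r + (of_rat q - r) / 2" q x]
        by (intro exI[of _ "(of_rat q - r) / 2"]) (auto simp: field_simps)
    qed
    then show ?thesis
      by (subst continuous_at_right_real_increasing) (auto intro: F_mono)
  qed
  have F_bot: "(F x \<longlongrightarrow> 0) at_bot" for x
  proof (rule tendsto_eventually)
    have "F x r = 0" if "r < a" for r
    proof -
      obtain q where "r < of_rat q" "of_rat q < a"
        using of_rat_dense[OF \<open>r < a\<close>] by blast
      then have "F x r \<le> 0"
        using F_le[of r q x] by (simp add: G_def)
      with F_01(1)[of x r] show ?thesis by simp
    qed
    then show "\<forall>\<^sub>F r in at_bot. F x r = 0"
      unfolding eventually_at_bot_dense by blast
  qed
  have F_top: "(F x \<longlongrightarrow> 1) at_top" for x
  proof (rule tendsto_eventually)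
    have "F x r = 1" if "b < r" for r
    proof (rule antisym)
      show "1 \<le> F x r"
        using that ab by (intro F_ge) (simp add: G_def)
    qed (rule F_01)
    then show "\<forall>\<^sub>F r in at_top. F x r = 1"
      unfolding eventually_at_top_dense by blast
  qed
  have F_meas [measurable]: "(\<lambda>x. F x r) \<in> borel_measurable A" for r
    unfolding F_def by measurable
  have G_eq: "AE x in ?L. \<forall>q. ennreal (G x q) = p (of_rat q) x"
  proof -
    have "AE x in ?L. \<forall>q r. q \<le> r \<longrightarrow> p (of_rat q) x \<le> p (of_rat r) x"
      by (auto simp: AE_all_countable of_rat_less_eq intro!: p_mono)
    moreover have "AE x in ?L. \<forall>q. of_rat q < a \<longrightarrow> p (of_rat q) x = 0"
      by (auto simp: AE_all_countable intro!: p_0)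
    moreover have "AE x in ?L. \<forall>q. b \<le> of_rat q \<longrightarrow> p (of_rat q) x = 1"
      by (auto simp: AE_all_countable intro!: p_1)
    ultimately show ?thesis
    proof eventually_elim
      case (elim x)
      \<comment> \<open>At a rational beyond \<open>b\<close> the version equals 1, and monotonicity
        carries this bound down to \<open>q\<close>.\<close>
      have le_1: "p (of_rat q) x \<le> 1" for q
      proof -
        obtain r where r: "max b (of_rat q) < of_rat r"
          using rat_above by blast
        then have "q \<le> r"
          using of_rat_less_eq[of q r, where 'a = real] by linarith
        with elim r show ?thesis
          by (metis less_imp_le max_less_iff_conj)
      qed
      have "(SUP s\<in>{..q}. min 1 (p (of_rat s) x)) = p (of_rat q) x" for q
        using elim(1) le_1 by (intro antisym SUP_least SUP_upper2[of q]) (auto simp: min_absorb2)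
      moreover have "ennreal (enn2real (p (of_rat q) x)) = p (of_rat q) x"
        "enn2real (p (of_rat q) x) \<le> 1" for q
        using le_1[of q] by (auto intro!: ennreal_enn2real enn2real_leI intro: le_less_trans[of _ 1])
      ultimately show ?case
        using elim(2,3) by (auto simp: G_def min_absorb2)
    qed
  qed
  \<comment> \<open>Upper bound: a rational \<open>q\<close> between \<open>r\<close> and
    \<open>r + 1 / Suc n\<close> gives \<open>F x r \<le> p (of_rat q) x\<close>, and the events
    \<open>S n\<close> decrease to \<open>Z \<le> r\<close>. Lower bound: \<open>p r x\<close> lies
    below \<open>G x q\<close> for every rational \<open>q\<close> above \<open>r\<close>, hence
    below the infimum.\<close>
  have int_F: "(\<integral>\<^sup>+x. ennreal (F x r) * indicator B x \<partial>?L) = emeasure \<mu> (Y -` B \<inter> {\<omega>\<in>space \<mu>. Z \<omega> \<le> r})"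
    if [measurable]: "B \<in> sets A" for B r
  proof (rule antisym)
    define S where "S n = Y -` B \<inter> {\<omega>\<in>space \<mu>. Z \<omega> \<le> r + 1 / Suc n}" for n
    have S_alt: "S n = {\<omega>\<in>space \<mu>. Y \<omega> \<in> B \<and> Z \<omega> \<le> r + 1 / Suc n}" for n
      by (auto simp: S_def)
    have S_sets: "S n \<in> sets \<mu>" for n
      unfolding S_alt by measurable
    have "(\<integral>\<^sup>+x. ennreal (F x r) * indicator B x \<partial>?L) \<le> emeasure \<mu> (S n)" for n
    proof -
      obtain q where q: "r < of_rat q" "of_rat q < r + 1 / Suc n"
        using of_rat_dense[of r "r + 1 / Suc n"] by auto
      have "(\<integral>\<^sup>+x. ennreal (F x r) * indicator B x \<partial>?L) \<le> (\<integral>\<^sup>+x. p (of_rat q) x * indicator B x \<partial>?L)"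
      proof (rule nn_integral_mono_AE)
        show "AE x in ?L. ennreal (F x r) * indicator B x \<le> p (of_rat q) x * indicator B x"
          using G_eq
        proof eventually_elim
          case (elim x)
          then have "ennreal (F x r) \<le> p (of_rat q) x"
            using F_le[OF q(1), of x] by (metis ennreal_leI)
          then show ?case
            by (intro mult_right_mono) auto
        qed
      qed
      also have "\<dots> = emeasure \<mu> (Y -` B \<inter> {\<omega>\<in>space \<mu>. Z \<omega> \<le> of_rat q})"
        by (rule int_p) fact
      also have "\<dots> \<le> emeasure \<mu> (S n)"
        using q(2) S_sets by (intro emeasure_mono) (auto simp: S_def)
      finally show ?thesis .
    qed
    then have "(\<integral>\<^sup>+x. ennreal (F x r) * indicator B x \<partial>?L) \<le> (INF n. emeasure \<mu> (S n))"
      by (rule INF_greatest)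
    also have "\<dots> = emeasure \<mu> (\<Inter>n. S n)"
    proof (rule INF_emeasure_decseq)
      show "decseq S"
      proof (rule decseq_SucI)
        show "S (Suc n) \<subseteq> S n" for n
          using frac_le[of 1 1 "real (Suc n)" "real (Suc (Suc n))"]
          by (auto simp: S_def simp del: of_nat_Suc)
      qed
    qed (use S_sets in auto)
    also have "(\<Inter>n. S n) = Y -` B \<inter> {\<omega>\<in>space \<mu>. Z \<omega> \<le> r}"
    proof -
      have "z \<le> r" if "\<forall>n. z \<le> r + 1 / Suc n" for z
        using that LIMSEQ_le_const[of "\<lambda>n. r + 1 / Suc n" r z]
          tendsto_add[OF tendsto_const LIMSEQ_Suc[OF lim_1_over_n], of r] by auto
      then show ?thesis
        by (auto simp: S_def intro: order_trans)
    qed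
    finally show "(\<integral>\<^sup>+x. ennreal (F x r) * indicator B x \<partial>?L) \<le> emeasure \<mu> (Y -` B \<inter> {\<omega>\<in>space \<mu>. Z \<omega> \<le> r})" .
  next
    have "emeasure \<mu> (Y -` B \<inter> {\<omega>\<in>space \<mu>. Z \<omega> \<le> r}) = (\<integral>\<^sup>+x. p r x * indicator B x \<partial>?L)"
      by (simp add: int_p)
    also have "\<dots> \<le> (\<integral>\<^sup>+x. ennreal (F x r) * indicator B x \<partial>?L)"
    proof (rule nn_integral_mono_AE)
      have "AE x in ?L. \<forall>q. r < of_rat q \<longrightarrow> p r x \<le> p (of_rat q) x"
        by (auto simp: AE_all_countable intro!: p_mono)
      with G_eq show "AE x in ?L. p r x * indicator B x \<le> ennreal (F x r) * indicator B x"
      proof eventually_elim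
        case (elim x)
        then have *: "p r x \<le> ennreal (G x q)" if "r < of_rat q" for q
          using that by simp
        obtain q where "r < of_rat q" using rat_above by blast
        then have "p r x < top"
          using * ennreal_less_top le_less_trans by blast
        then have fin: "p r x = ennreal (enn2real (p r x))"
          by simp
        have "enn2real (p r x) \<le> F x r"
          using * G_01 by (intro F_ge enn2real_leI) auto
        then have "p r x \<le> ennreal (F x r)"
          using fin by (metis ennreal_leI)
        then show ?case
          by (intro mult_right_mono) auto
      qed
    qed
    finally show "emeasure \<mu> (Y -` B \<inter> {\<omega>\<in>space \<mu>. Z \<omega> \<le> r}) \<le> (\<integral>\<^sup>+x. ennreal (F x r) * indicator B x \<partial>?L)" .
  qed

  define \<kappa> where "\<kappa> x = interval_measure (F x)" for x
  have \<kappa>_Iic: "emeasure (\<kappa> x) {..r} = ennreal (F x r)" for x r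
    unfolding \<kappa>_def by (rule emeasure_interval_measure_Iic[where F = "F x", OF F_mono F_right F_bot])
  have gen: "sets (borel :: real measure) = sigma_sets UNIV (range atMost)"
    by (subst borel_eq_atMost) simp
  have stable: "Int_stable (range (atMost :: real \<Rightarrow> _))"
    by (auto simp: Int_stable_def)
  have \<kappa> [measurable]: "\<kappa> \<in> A \<rightarrow>\<^sub>M prob_algebra borel"
  proof (rule measurable_prob_algebra_generated[OF gen stable])
    fix x
    show "prob_space (\<kappa> x)"
      unfolding \<kappa>_def using real_distribution_interval_measure[where F = "F x", OF F_mono F_right F_bot F_top]
      by (rule real_distribution.axioms(1))
    show "sets (\<kappa> x) = sets borel"
      by (simp add: \<kappa>_def)
  qed (auto simp: \<kappa>_Iic)
  note \<kappa>_sub [measurable] = measurable_prob_algebraD[OF \<kappa>]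
  show ?thesis
  proof (intro bexI[OF _ \<kappa>] ballI)
    fix B and C :: "real set" assume [measurable]: "B \<in> sets A" and C [measurable]: "C \<in> sets borel"
    let ?M = "density ?L (indicator B)" and ?N = "density \<mu> (indicator (Y -` B \<inter> space \<mu>))"
    have ne: "space A \<noteq> {}"
      using law.not_empty by simp
    have 1: "emeasure (bind ?M \<kappa>) C = (\<integral>\<^sup>+x. emeasure (\<kappa> x) C * indicator B x \<partial>?L)"
      if [measurable]: "C \<in> sets borel" for C
      by (subst emeasure_bind[where N = borel])
         (auto simp: ne nn_integral_density mult.commute cong: measurable_cong_sets)
    have 2: "emeasure (distr ?N borel Z) C = emeasure \<mu> (Y -` B \<inter> Z -` C \<inter> space \<mu>)"
      if [measurable]: "C \<in> sets borel" for C
    proof -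
      have "emeasure (distr ?N borel Z) C =
          (\<integral>\<^sup>+\<omega>. indicator (Y -` B \<inter> space \<mu>) \<omega> * indicator (Z -` C \<inter> space \<mu>) \<omega> \<partial>\<mu>)"
        by (subst emeasure_distr) (auto simp: emeasure_density)
      also have "\<dots> = (\<integral>\<^sup>+\<omega>. indicator ((Y -` B \<inter> space \<mu>) \<inter> (Z -` C \<inter> space \<mu>)) \<omega> \<partial>\<mu>)"
        by (intro nn_integral_cong) (auto simp: indicator_def)
      also have "\<dots> = emeasure \<mu> ((Y -` B \<inter> space \<mu>) \<inter> (Z -` C \<inter> space \<mu>))"
        by (rule nn_integral_indicator) measurable
      also have "(Y -` B \<inter> space \<mu>) \<inter> (Z -` C \<inter> space \<mu>) = Y -` B \<inter> Z -` C \<inter> space \<mu>"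
        by auto
      finally show ?thesis .
    qed
    have "distr ?N borel Z = bind ?M \<kappa>"
    proof (rule measure_eqI_generator_eq[OF stable, where A = "\<lambda>n. {..real n}"])
      fix X :: "real set" assume "X \<in> range atMost"
      then obtain r where X: "X = {..r}" by auto
      have "Y -` B \<inter> Z -` {..r} \<inter> space \<mu> = Y -` B \<inter> {\<omega>\<in>space \<mu>. Z \<omega> \<le> r}"
        by auto
      then show "emeasure (distr ?N borel Z) X = emeasure (bind ?M \<kappa>) X"
        by (simp add: X 1 2 \<kappa>_Iic int_F)
    next
      show "sets (bind ?M \<kappa>) = sigma_sets UNIV (range atMost)"
        unfolding gen[symmetric]
        by (rule sets_bind_measurable) (auto simp: ne cong: measurable_cong_sets)
      show "(\<Union>n. {..real n}) = UNIV"
        using real_arch_simple by auto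
    qed (auto simp: gen 2)
    then show "(\<integral>\<^sup>+x. emeasure (\<kappa> x) C * indicator B x \<partial>?L) = emeasure \<mu> (Y -` B \<inter> Z -` C \<inter> space \<mu>)"
      using 1[OF C] 2[OF C] by simp
  qed
qed


section \<open>Disintegrations\<close>

text \<open>The sets that fail to distinguish \<open>x\<close> from \<open>y\<close> form a
  \<sigma>-algebra. If it contained the countable generator, it would contain the singleton of
  \<open>x\<close> as well.\<close>

lemma conditionable_separating:
  assumes "conditionable A"
  shows "\<exists>C. countable C \<and> C \<subseteq> sets A \<and>
    (\<forall>x\<in>space A. \<forall>y\<in>space A. (\<forall>c\<in>C. x \<in> c \<longleftrightarrow> y \<in> c) \<longrightarrow> x = y)"
proof -
  obtain C where C: "countable C" "C \<subseteq> Pow (space A)" "sets A = sigma_sets (space A) C"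
    using assms by (auto simp: conditionable_def countably_generated_def)
  have "x = y" if xy: "x \<in> space A" "y \<in> space A" and agree: "\<forall>c\<in>C. x \<in> c \<longleftrightarrow> y \<in> c" for x y
  proof -
    have "x \<in> S \<longleftrightarrow> y \<in> S" if "S \<in> sigma_sets (space A) C" for S
      using that by induction (use xy agree in auto)
    moreover have "{x} \<in> sigma_sets (space A) C"
      using assms xy(1) C(3) by (auto simp: conditionable_def)
    ultimately show ?thesis by blast
  qed
  moreover have "C \<subseteq> sets A"
    by (auto simp: C(3))
  ultimately show ?thesis
    using C(1) by (intro exI[of _ C] conjI ballI impI)
qed

text \<open>A countable set has countably many finite subsets, so closing a generator under finite
  intersections keeps it countable. Equality of two measures then follows from countably many
  checks; the empty intersection contributes the whole space, which bounds the total mass.\<close>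

lemma countably_generated_Int_stable:
  assumes "countably_generated P"
  shows "\<exists>G. countable G \<and> Int_stable G \<and> G \<subseteq> Pow (space P) \<and> space P \<in> G \<and> sets P = sigma_sets (space P) G"
proof -
  obtain C where C: "countable C" "C \<subseteq> Pow (space P)" "sets P = sigma_sets (space P) C"
    using assms by (auto simp: countably_generated_def)
  define G where "G = (\<lambda>K. space P \<inter> \<Inter>K) ` {K. finite K \<and> K \<subseteq> C}"
  have "countable G"
    unfolding G_def using countable_Collect_finite_subset[OF C(1)] by (rule countable_image)
  moreover have "Int_stable G"
  proof (rule Int_stableI)
    fix a b assume "a \<in> G" "b \<in> G"
    then obtain K L where "finite K" "K \<subseteq> C" "a = space P \<inter> \<Inter>K" "finite L" "L \<subseteq> C" "b = space P \<inter> \<Inter>L"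
      unfolding G_def by blast
    then show "a \<inter> b \<in> G"
      unfolding G_def by (intro image_eqI[of _ _ "K \<union> L"]) auto
  qed
  moreover have "space P \<in> G"
    unfolding G_def by (rule image_eqI[of _ _ "{}"]) auto
  moreover have "sets P = sigma_sets (space P) G"
    unfolding C(3)
  proof (rule sigma_sets_eqI)
    fix c assume c: "c \<in> C"
    then have "c \<in> G"
      unfolding G_def using C(2) by (intro image_eqI[of _ _ "{c}"]) auto
    then show "c \<in> sigma_sets (space P) G" ..
  next
    fix g assume "g \<in> G"
    then obtain K where K: "finite K" "K \<subseteq> C" "g = space P \<inter> \<Inter>K"
      unfolding G_def by blast
    have "K \<subseteq> sets P"
      using K(2) by (auto simp: C(3))
    with K(1) have "space P \<inter> \<Inter>K \<in> sets P"
    proof (induction K rule: finite_induct)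
      case (insert k K)
      then have "k \<inter> (space P \<inter> \<Inter>K) \<in> sets P" by auto
      then show ?case by (simp add: Int_left_commute)
    qed simp
    then show "g \<in> sigma_sets (space P) C"
      by (simp add: K(3) C(3))
  qed
  moreover have "G \<subseteq> Pow (space P)"
    by (auto simp: G_def)
  ultimately show ?thesis
    by (intro exI[of _ G] conjI)
qed

lemma prob_algebra_space_eq: "\<mu> \<in> space (prob_algebra M) \<Longrightarrow> space \<mu> = space M"
  by (auto simp: space_prob_algebra dest: sets_eq_imp_space_eq)

lemma disintegration_Int:
  assumes disint: "disintegration \<mu> A Y \<nu>" and \<mu>: "\<mu> \<in> space (prob_algebra Omega)"
    and Y [measurable]: "Y \<in> Omega \<rightarrow>\<^sub>M A" and B [measurable]: "B \<in> sets A" and F [measurable]: "F \<in> sets Omega"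
  shows "(\<integral>\<^sup>+x. emeasure (\<nu> x) F * indicator B x \<partial>distr \<mu> A Y) = emeasure \<mu> (Y -` B \<inter> F)"
proof -
  have sets_\<mu> [measurable_cong]: "sets \<mu> = sets Omega"
    using \<mu> by (simp add: space_prob_algebra)
  have S: "Y -` B \<inter> F \<in> sets Omega"
  proof -
    have "Y -` B \<inter> F = (Y -` B \<inter> space Omega) \<inter> F"
      using sets.sets_into_space[OF F] by auto
    then show ?thesis by simp
  qed
  let ?f = "indicator (Y -` B \<inter> F) :: sample \<Rightarrow> real"
  have "emeasure \<mu> (Y -` B \<inter> F) = (\<integral>\<^sup>+\<omega>. ennreal (?f \<omega>) \<partial>\<mu>)"
    using S by (simp add: ennreal_indicator sets_\<mu>)
  also have "\<dots> = (\<integral>\<^sup>+x. (\<integral>\<^sup>+\<omega>. ennreal (?f \<omega>) \<partial>\<nu> x) \<partial>distr \<mu> A Y)"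
    using disint S unfolding disintegration_def by auto
  also have "\<dots> = (\<integral>\<^sup>+x. emeasure (\<nu> x) F * indicator B x \<partial>distr \<mu> A Y)"
  proof (rule nn_integral_cong_AE)
    have "AE x in distr \<mu> A Y. emeasure (\<nu> x) {\<omega>\<in>space Omega. Y \<omega> = x} = 1"
      using disint by (simp add: disintegration_def)
    then show "AE x in distr \<mu> A Y. (\<integral>\<^sup>+\<omega>. ennreal (?f \<omega>) \<partial>\<nu> x) = emeasure (\<nu> x) F * indicator B x"
      using AE_space
    proof eventually_elim
      case (elim x)
      have \<nu>x: "prob_space (\<nu> x)" "sets (\<nu> x) = sets Omega"
        using disint elim(2) by (auto simp: disintegration_def space_prob_algebra)
      interpret prob_space "\<nu> x" by fact
      \<comment> \<open>Measure 1 already entails that the fibre is measurable, because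
        \<open>emeasure\<close> is 0 off the \<sigma>-algebra.\<close>
      have "AE \<omega> in \<nu> x. \<omega> \<in> {\<omega>\<in>space Omega. Y \<omega> = x}"
        by (rule AE_prob_1) (use elim(1) in \<open>simp add: emeasure_eq_measure\<close>)
      then have "(\<integral>\<^sup>+\<omega>. ennreal (?f \<omega>) \<partial>\<nu> x) = (\<integral>\<^sup>+\<omega>. indicator B x * indicator F \<omega> \<partial>\<nu> x)"
        by (intro nn_integral_cong_AE, eventually_elim) (auto simp: indicator_def)
      also have "\<dots> = emeasure (\<nu> x) F * indicator B x"
        using F by (subst nn_integral_cmult) (auto simp: \<nu>x(2) mult.commute intro!: borel_measurable_indicator)
      finally show ?case .
    qed
  qed
  finally show ?thesis ..
qed

lemma disintegration_measurable:
  assumes "disintegration \<mu> A Y \<nu>" "F \<in> sets Omega"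
  shows "(\<lambda>x. emeasure (\<nu> x) F) \<in> borel_measurable A"
proof -
  have "(\<lambda>x. \<integral>\<^sup>+\<omega>. ennreal (indicator F \<omega>) \<partial>\<nu> x) \<in> borel_measurable A"
    using assms unfolding disintegration_def by auto
  moreover have "(\<integral>\<^sup>+\<omega>. ennreal (indicator F \<omega>) \<partial>\<nu> x) = emeasure (\<nu> x) F" if "x \<in> space A" for x
  proof -
    have "sets (\<nu> x) = sets Omega"
      using assms(1) that by (auto simp: disintegration_def space_prob_algebra)
    then show ?thesis
      using assms(2) by (simp add: ennreal_indicator)
  qed
  ultimately show ?thesis
    by (subst measurable_cong[where g = "\<lambda>x. \<integral>\<^sup>+\<omega>. ennreal (indicator F \<omega>) \<partial>\<nu> x"]) auto
qed

text \<open>The regular conditional distribution of \<open>encode\<close> given \<open>Y\<close> is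
  pushed forward along \<open>decode\<close>. Since \<open>decode\<close> inverts
  \<open>encode\<close> on the sample space, the result is a conditional law of the sample itself;
  the properties of \<open>A\<close> are what concentrate it on the fibres.\<close>

lemma disintegration_exists:
  assumes A: "conditionable A" and \<mu>: "\<mu> \<in> space (prob_algebra Omega)" and Y [measurable]: "Y \<in> Omega \<rightarrow>\<^sub>M A"
  shows "\<exists>\<nu>. disintegration \<mu> A Y \<nu>"
proof -
  have sets_\<mu> [measurable_cong]: "sets \<mu> = sets Omega" and "prob_space \<mu>"
    using \<mu> by (auto simp: space_prob_algebra)
  have space_\<mu>: "space \<mu> = space Omega"
    using \<mu> by (rule prob_algebra_space_eq)
  let ?L = "distr \<mu> A Y"
  interpret law: prob_space ?L
    using \<open>prob_space \<mu>\<close> by (rule prob_space.prob_space_distr) measurable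
  have "Y \<in> \<mu> \<rightarrow>\<^sub>M A" "encode \<in> borel_measurable \<mu>" by measurable
  from regular_conditional_distribution[OF \<open>prob_space \<mu>\<close> this encode_bounds]
  obtain \<kappa> where \<kappa> [measurable]: "\<kappa> \<in> A \<rightarrow>\<^sub>M prob_algebra borel"
    and int_\<kappa>: "\<And>B C. B \<in> sets A \<Longrightarrow> C \<in> sets borel \<Longrightarrow>
      (\<integral>\<^sup>+x. emeasure (\<kappa> x) C * indicator B x \<partial>?L) = emeasure \<mu> (Y -` B \<inter> encode -` C \<inter> space \<mu>)"
    by blast
  define \<nu> where "\<nu> x = distr (\<kappa> x) Omega decode" for x
  have \<nu> [measurable]: "\<nu> \<in> A \<rightarrow>\<^sub>M prob_algebra Omega"
    unfolding \<nu>_def by (rule measurable_compose[OF \<kappa> measurable_distr_prob_space[OF measurable_decode]])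
  note \<nu>_sub [measurable] = measurable_prob_algebraD[OF \<nu>]
  have \<nu>_space: "\<nu> x \<in> space (prob_algebra Omega)" if "x \<in> space A" for x
    using \<nu> that by (rule measurable_space)
  have int_\<nu>: "(\<integral>\<^sup>+x. emeasure (\<nu> x) C * indicator B x \<partial>?L) = emeasure \<mu> (Y -` B \<inter> C)"
    if [measurable]: "B \<in> sets A" and C [measurable]: "C \<in> sets Omega" for B C
  proof -
    have "decode -` C \<in> sets borel"
      using measurable_sets[OF measurable_decode C] by simp
    have "(\<integral>\<^sup>+x. emeasure (\<nu> x) C * indicator B x \<partial>?L) =
        (\<integral>\<^sup>+x. emeasure (\<kappa> x) (decode -` C) * indicator B x \<partial>?L)"
    proof (rule nn_integral_cong)
      fix x assume "x \<in> space ?L"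
      then have "\<kappa> x \<in> space (prob_algebra borel)"
        using measurable_space[OF \<kappa>] by simp
      then have "sets (\<kappa> x) = sets borel" "space (\<kappa> x) = UNIV"
        by (auto simp: space_prob_algebra dest: sets_eq_imp_space_eq)
      then show "emeasure (\<nu> x) C * indicator B x = emeasure (\<kappa> x) (decode -` C) * indicator B x"
        unfolding \<nu>_def by (subst emeasure_distr) (auto cong: measurable_cong_sets)
    qed
    also have "\<dots> = emeasure \<mu> (Y -` B \<inter> encode -` (decode -` C) \<inter> space \<mu>)"
      by (rule int_\<kappa>) fact+
    also have "Y -` B \<inter> encode -` (decode -` C) \<inter> space \<mu> = Y -` B \<inter> C"
      using sets.sets_into_space[OF C] by (auto simp: space_\<mu> decode_encode)
    finally show ?thesis .
  qed
  \<comment> \<open>This is the case \<open>B = space A\<close> of \<open>int_\<nu>\<close>; stated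
    as an equality of measures it yields the integral formula for all nonnegative functions at
    once.\<close>
  have bind: "bind ?L \<nu> = \<mu>"
  proof (rule measure_eqI)
    show sets: "sets (bind ?L \<nu>) = sets \<mu>"
      using law.not_empty by (subst sets_bind_measurable[where B = Omega]) (auto simp: sets_\<mu> cong: measurable_cong_sets)
    fix C assume "C \<in> sets (bind ?L \<nu>)"
    then have C: "C \<in> sets Omega"
      using sets sets_\<mu> by simp
    have "emeasure (bind ?L \<nu>) C = (\<integral>\<^sup>+x. emeasure (\<nu> x) C \<partial>?L)"
      using C law.not_empty by (subst emeasure_bind[where N = Omega]) (auto cong: measurable_cong_sets)
    also have "\<dots> = (\<integral>\<^sup>+x. emeasure (\<nu> x) C * indicator (space A) x \<partial>?L)"
      by (intro nn_integral_cong) simp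
    also have "\<dots> = emeasure \<mu> (Y -` space A \<inter> C)"
      using C by (intro int_\<nu>) auto
    also have "Y -` space A \<inter> C = C"
      using sets.sets_into_space[OF C] measurable_space[OF Y] by auto
    finally show "emeasure (bind ?L \<nu>) C = emeasure \<mu> C" .
  qed
  obtain S where S: "countable S" "S \<subseteq> sets A"
    and sep: "\<And>x y. x \<in> space A \<Longrightarrow> y \<in> space A \<Longrightarrow> (\<And>c. c \<in> S \<Longrightarrow> x \<in> c \<longleftrightarrow> y \<in> c) \<Longrightarrow> x = y"
    using conditionable_separating[OF A] by metis
  txt \<open>Almost every \<open>\<nu> x\<close> gives each set of the countable separating family the probability 0 or 1
    prescribed by \<open>x\<close>, which pins \<open>Y\<close> to \<open>x\<close>.\<close>
  have "AE x in ?L. emeasure (\<nu> x) (Y -` c \<inter> space Omega) = indicator c x" if "c \<in> S" for c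
  proof (rule law.density_unique_finite_measure)
    have c [measurable]: "c \<in> sets A"
      using that S by auto
    show "(\<lambda>x. emeasure (\<nu> x) (Y -` c \<inter> space Omega)) \<in> borel_measurable ?L"
      "indicator c \<in> borel_measurable ?L"
      by measurable
    fix B assume "B \<in> sets ?L"
    then have B [measurable]: "B \<in> sets A" by simp
    \<comment> \<open>Integrated over \<open>B\<close>, both functions give the mass of
      \<open>c \<inter> B\<close> under the law of \<open>Y\<close>.\<close>
    have "(\<integral>\<^sup>+x. emeasure (\<nu> x) (Y -` c \<inter> space Omega) * indicator B x \<partial>?L) = emeasure \<mu> (Y -` (c \<inter> B) \<inter> space Omega)"
      by (subst int_\<nu>) (auto intro!: arg_cong[of _ _ "emeasure \<mu>"])
    also have "\<dots> = emeasure ?L (c \<inter> B)"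
      by (subst emeasure_distr) (auto simp: space_\<mu>)
    also have "\<dots> = (\<integral>\<^sup>+x. indicator c x * indicator B x \<partial>?L)"
      by (simp add: nn_integral_indicator[symmetric] indicator_inter_arith del: nn_integral_indicator)
    finally show "(\<integral>\<^sup>+x. emeasure (\<nu> x) (Y -` c \<inter> space Omega) * indicator B x \<partial>?L) =
        (\<integral>\<^sup>+x. indicator c x * indicator B x \<partial>?L)" .
  qed auto
  then have "AE x in ?L. \<forall>c\<in>S. emeasure (\<nu> x) (Y -` c \<inter> space Omega) = indicator c x"
    using S(1) by (simp add: AE_ball_countable)
  then have fibre: "AE x in ?L. emeasure (\<nu> x) {\<omega>\<in>space Omega. Y \<omega> = x} = 1"
    using AE_space
  proof eventually_elim
    case (elim x)
    then have x: "x \<in> space A" by simp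
    then have \<nu>x: "prob_space (\<nu> x)" "sets (\<nu> x) = sets Omega" "space (\<nu> x) = space Omega"
      using \<nu>_space[OF x] prob_algebra_space_eq[OF \<nu>_space[OF x]] by (simp_all add: space_prob_algebra)
    interpret prob_space "\<nu> x" by fact
    have "AE \<omega> in \<nu> x. Y \<omega> \<in> c \<longleftrightarrow> x \<in> c" if "c \<in> S" for c
    proof (cases "x \<in> c")
      case True
      then have "AE \<omega> in \<nu> x. \<omega> \<in> Y -` c \<inter> space Omega"
        using elim(1) that by (intro AE_prob_1) (auto simp: measure_def)
      with True show ?thesis by auto
    next
      case False
      have "Y -` c \<inter> space Omega \<in> sets Omega"
        using that S(2) measurable_sets[OF Y] by auto
      then have "Y -` c \<inter> space Omega \<in> null_sets (\<nu> x)"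
        using elim(1) that False \<nu>x(2) by (auto simp: null_sets_def)
      then have "AE \<omega> in \<nu> x. \<omega> \<notin> Y -` c \<inter> space Omega"
        by (rule AE_not_in)
      then show ?thesis
        using AE_space by eventually_elim (use False \<nu>x(3) in auto)
    qed
    then have "AE \<omega> in \<nu> x. \<forall>c\<in>S. Y \<omega> \<in> c \<longleftrightarrow> x \<in> c"
      using S(1) by (simp add: AE_ball_countable)
    then have "AE \<omega> in \<nu> x. \<omega> \<in> {\<omega>\<in>space Omega. Y \<omega> = x}"
      using AE_space
    proof eventually_elim
      case (elim \<omega>)
      then show ?case
        using sep[of "Y \<omega>" x] x measurable_space[OF Y] \<nu>x(3) by auto
    qed
    moreover have "{\<omega>\<in>space Omega. Y \<omega> = x} = Y -` {x} \<inter> space Omega"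
      by auto
    then have "{\<omega>\<in>space Omega. Y \<omega> = x} \<in> sets (\<nu> x)"
      using A x measurable_sets[OF Y, of "{x}"] by (simp add: conditionable_def \<nu>x(2))
    ultimately show ?case
      by (intro emeasure_eq_1_AE)
  qed
  show ?thesis
    unfolding disintegration_def
  proof (intro exI[of _ \<nu>] conjI ballI impI)
    fix f :: "sample \<Rightarrow> real" assume [measurable]: "f \<in> borel_measurable Omega"
    show "(\<lambda>x. \<integral>\<^sup>+\<omega>. ennreal (f \<omega>) \<partial>\<nu> x) \<in> borel_measurable A"
      by (rule measurable_compose[OF \<nu>_sub nn_integral_measurable_subprob_algebra]) measurable
    show "(\<integral>\<^sup>+\<omega>. ennreal (f \<omega>) \<partial>\<mu>) = (\<integral>\<^sup>+x. \<integral>\<^sup>+\<omega>. ennreal (f \<omega>) \<partial>\<nu> x \<partial>?L)"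
      by (subst bind[symmetric], rule nn_integral_bind[where B = Omega]) (auto cong: measurable_cong_sets)
  qed (use \<nu>_space fibre in auto)
qed


section \<open>Monotonicity of satisfaction\<close>

lemma extended_by_trans: "P \<sqsubseteq>\<^sub>r Q \<Longrightarrow> Q \<sqsubseteq>\<^sub>r R \<Longrightarrow> P \<sqsubseteq>\<^sub>r R"
  by (auto simp: extended_by_def subalgebra_def)

text \<open>Rewriting the extension order as an equation makes the general facts on integrals over
  subalgebras applicable to it.\<close>

lemma extended_by_eq_restr:
  assumes "P \<sqsubseteq>\<^sub>r Q" shows "P = restr_to_subalg Q P"
  using assms by (intro measure_eqI) (auto simp: extended_by_def sets_restr_to_subalg emeasure_restr_to_subalg)

lemma restr_extended_by:
  assumes "subalgebra M F" shows "restr_to_subalg M F \<sqsubseteq>\<^sub>r M"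
  using assms by (auto simp: extended_by_def sets_restr_to_subalg emeasure_restr_to_subalg
      subalgebra_def space_restr_to_subalg)

lemma extended_by_measurable: "P \<sqsubseteq>\<^sub>r Q \<Longrightarrow> X \<in> P \<rightarrow>\<^sub>M A \<Longrightarrow> X \<in> Q \<rightarrow>\<^sub>M A"
  unfolding extended_by_def by (blast intro: measurable_from_subalg)

lemma extended_by_distr:
  assumes "P \<sqsubseteq>\<^sub>r Q" "X \<in> P \<rightarrow>\<^sub>M A"
  shows "distr Q A X = distr P A X"
proof (rule measure_eqI)
  fix B assume "B \<in> sets (distr Q A X)"
  moreover have "space P = space Q"
    using assms(1) by (simp add: extended_by_def subalgebra_def)
  ultimately show "emeasure (distr Q A X) B = emeasure (distr P A X) B"
    using assms measurable_sets[OF assms(2), of B]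
    by (simp add: emeasure_distr extended_by_measurable[OF assms]) (simp add: extended_by_def)
qed simp

lemma extended_by_nn_integral:
  assumes "P \<sqsubseteq>\<^sub>r Q" "f \<in> borel_measurable P"
  shows "(\<integral>\<^sup>+\<omega>. f \<omega> \<partial>P) = (\<integral>\<^sup>+\<omega>. f \<omega> \<partial>Q)"
  using extended_by_eq_restr[OF assms(1)] nn_integral_subalgebra2[OF _ assms(2), of Q] assms(1)
  by (simp add: extended_by_def)

lemma extended_by_has_bochner_integral:
  fixes f :: "_ \<Rightarrow> real"
  assumes "P \<sqsubseteq>\<^sub>r Q" "f \<in> borel_measurable P"
  shows "has_bochner_integral P f c \<longleftrightarrow> has_bochner_integral Q f c"
proof -
  have sub: "subalgebra Q P"
    using assms(1) by (simp add: extended_by_def)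
  show ?thesis
    using integrable_from_subalg[OF sub, of f] integrable_in_subalg[OF sub assms(2)]
      integral_subalgebra2[OF sub assms(2)]
    unfolding extended_by_eq_restr[OF assms(1), symmetric] has_bochner_integral_iff by auto
qed

lemma restr_extended_by_restr:
  assumes "sets P \<subseteq> sets Q" "subalgebra M Q" "space P = space Q"
  shows "restr_to_subalg M P \<sqsubseteq>\<^sub>r restr_to_subalg M Q"
proof -
  have "subalgebra M P"
    using assms by (auto simp: subalgebra_def)
  then show ?thesis
    using assms by (auto simp: extended_by_def subalgebra_def sets_restr_to_subalg
        emeasure_restr_to_subalg space_restr_to_subalg)
qed

section \<open>Resources under a change of measure\<close>

lemma countably_generated_sets_cong:
  "sets P = sets Q \<Longrightarrow> countably_generated P \<longleftrightarrow> countably_generated Q"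
  using sets_eq_imp_space_eq[of P Q] by (simp add: countably_generated_def)

lemma finite_footprint_mono: "sets P \<subseteq> sets Q \<Longrightarrow> finite_footprint Q \<Longrightarrow> finite_footprint P"
  unfolding finite_footprint_def by (meson subsetD)

lemma subalgebra_prob_algebra:
  "\<mu> \<in> space (prob_algebra Omega) \<Longrightarrow> subalgebra Omega P \<Longrightarrow> subalgebra \<mu> P"
  using sets_eq_imp_space_eq[of \<mu> Omega] by (auto simp: space_prob_algebra subalgebra_def)

lemma resourceD:
  assumes "P \<in> resources"
  shows "prob_space P" "subalgebra Omega P" "countably_generated P" "finite_footprint P"
  using assms by (auto simp: resources_def)

text \<open>Countable generation and finite footprint concern only the \<sigma>-algebra, which is
  kept, and \<mu> itself is the required extension. The conditioning clause evaluates propositions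
  at such restrictions, so entailment and monotonicity can be applied there.\<close>

lemma restr_in_resources:
  assumes "P \<in> resources" "\<mu> \<in> space (prob_algebra Omega)"
  shows "restr_to_subalg \<mu> P \<in> resources"
proof -
  note P = resourceD[OF assms(1)]
  have sub: "subalgebra \<mu> P"
    using assms(2) P(2) by (rule subalgebra_prob_algebra)
  have space: "space \<mu> = space Omega"
    using assms(2) by (auto simp: space_prob_algebra dest: sets_eq_imp_space_eq)
  have "prob_space (restr_to_subalg \<mu> P)"
    using assms(2) by (intro prob_space_restr_to_subalg[OF sub]) (simp add: space_prob_algebra)
  then show ?thesis
    using P sub space countably_generated_sets_cong[OF sets_restr_to_subalg[OF sub]]
      finite_footprint_mono[of "restr_to_subalg \<mu> P" P] restr_extended_by[OF sub] assms(2)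
    by (auto simp: resources_def subalgebra_def sets_restr_to_subalg[OF sub] space_restr_to_subalg)
qed

section \<open>Independent combinations\<close>

text \<open>The product formula with the whole space as one of the two events reduces to the
  marginal.\<close>

lemma indep_comb_extends:
  assumes "indep_comb P Q R"
  shows "P \<sqsubseteq>\<^sub>r R" "Q \<sqsubseteq>\<^sub>r R"
proof -
  have res: "P \<in> resources" "Q \<in> resources" "R \<in> resources"
    and sets: "sets R = sigma_sets (space Omega) (sets P \<union> sets Q)"
    and ind: "\<And>E F. E \<in> sets P \<Longrightarrow> F \<in> sets Q \<Longrightarrow> emeasure R (E \<inter> F) = emeasure P E * emeasure Q F"
    using assms by (auto simp: indep_comb_def)
  have space: "space P = space Omega" "space Q = space Omega" "space R = space Omega"
    using res[THEN resourceD(2)] by (auto simp: subalgebra_def)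
  have one: "emeasure P (space Omega) = 1" "emeasure Q (space Omega) = 1"
    using prob_space.emeasure_space_1[OF resourceD(1)[OF res(1)]]
      prob_space.emeasure_space_1[OF resourceD(1)[OF res(2)]] by (simp_all add: space)
  have top: "space Omega \<in> sets P" "space Omega \<in> sets Q"
    using sets.top[of P] sets.top[of Q] by (simp_all add: space)
  have "emeasure P E = emeasure R E" if "E \<in> sets P" for E
    using ind[OF that top(2)] sets.sets_into_space[OF that] one by (simp add: space Int_absorb2)
  moreover have "emeasure Q F = emeasure R F" if "F \<in> sets Q" for F
    using ind[OF top(1) that] sets.sets_into_space[OF that] one by (simp add: space Int_absorb1)
  ultimately show "P \<sqsubseteq>\<^sub>r R" "Q \<sqsubseteq>\<^sub>r R"
    by (auto simp: extended_by_def subalgebra_def space sets)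
qed

text \<open>Independence passes to smaller \<sigma>-algebras, so \<open>R'\<close> restricted to the
  \<sigma>-algebra generated by \<open>P\<close> and \<open>Q\<close> is the combination. A frame
  compatible with a larger resource is hence compatible with a smaller one.\<close>

lemma indep_comb_mono:
  assumes comb: "indep_comb P Q' R'" and "Q \<in> resources" "Q \<sqsubseteq>\<^sub>r Q'"
  shows "\<exists>R. indep_comb P Q R \<and> R \<sqsubseteq>\<^sub>r R'"
proof -
  have res: "P \<in> resources" "Q' \<in> resources" "R' \<in> resources"
    and sets: "sets R' = sigma_sets (space Omega) (sets P \<union> sets Q')"
    and ind: "\<And>E F. E \<in> sets P \<Longrightarrow> F \<in> sets Q' \<Longrightarrow> emeasure R' (E \<inter> F) = emeasure P E * emeasure Q' F"
    using comb by (auto simp: indep_comb_def)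
  have space: "space P = space Omega" "space Q = space Omega" "space R' = space Omega"
    using res[THEN resourceD(2)] resourceD(2)[OF \<open>Q \<in> resources\<close>] by (auto simp: subalgebra_def)
  let ?S = "sigma (space Omega) (sets P \<union> sets Q)"
  have le: "sets P \<union> sets Q \<subseteq> Pow (space Omega)"
    using sets.space_closed[of P] sets.space_closed[of Q] by (auto simp: space)
  then have sets_S: "sets ?S = sigma_sets (space Omega) (sets P \<union> sets Q)"
    by simp
  have sub: "subalgebra R' ?S"
    using \<open>Q \<sqsubseteq>\<^sub>r Q'\<close> unfolding subalgebra_def sets_S sets
    by (auto simp: space extended_by_def subalgebra_def intro!: sigma_sets_mono' simp: space_measure_of_conv)
  define R where "R = restr_to_subalg R' ?S"
  have sets_R: "sets R = sigma_sets (space Omega) (sets P \<union> sets Q)"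
    unfolding R_def sets_restr_to_subalg[OF sub] sets_S ..
  have space_R: "space R = space Omega"
    by (simp add: R_def space_restr_to_subalg space)
  have R_le: "R \<sqsubseteq>\<^sub>r R'"
    unfolding R_def by (rule restr_extended_by[OF sub])
  \<comment> \<open>A sub-\<sigma>-algebra of a countably generated one need not be countably
    generated, so this cannot be inherited from \<open>R'\<close>; it comes from joining generators
    of \<open>P\<close> and \<open>Q\<close>.\<close>
  have "countably_generated R"
  proof -
    obtain C1 C2 where C: "countable C1" "C1 \<subseteq> Pow (space Omega)" "sets P = sigma_sets (space Omega) C1"
      "countable C2" "C2 \<subseteq> Pow (space Omega)" "sets Q = sigma_sets (space Omega) C2"
      using resourceD(3)[OF res(1)] resourceD(3)[OF \<open>Q \<in> resources\<close>]
      by (auto simp: countably_generated_def space)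
    have "sets R = sigma_sets (space Omega) (C1 \<union> C2)"
      unfolding sets_R C(3,6)
    proof (rule sigma_sets_eqI)
      fix a assume "a \<in> sigma_sets (space Omega) C1 \<union> sigma_sets (space Omega) C2"
      then show "a \<in> sigma_sets (space Omega) (C1 \<union> C2)"
        using sigma_sets_mono'[of C1 "C1 \<union> C2"] sigma_sets_mono'[of C2 "C1 \<union> C2"] by blast
    qed auto
    then show ?thesis
      using C(1,2,4,5) unfolding countably_generated_def space_R by (intro exI[of _ "C1 \<union> C2"]) auto
  qed
  moreover have "prob_space R"
    unfolding R_def by (rule prob_space_restr_to_subalg[OF sub resourceD(1)[OF res(3)]])
  moreover have "sets R \<subseteq> sets R'"
    using R_le by (simp add: extended_by_def subalgebra_def)
  moreover obtain \<mu> where "\<mu> \<in> space (prob_algebra Omega)" "R' \<sqsubseteq>\<^sub>r \<mu>"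
    using res(3) by (auto simp: resources_def)
  moreover have "R \<sqsubseteq>\<^sub>r \<mu>"
    using R_le \<open>R' \<sqsubseteq>\<^sub>r \<mu>\<close> by (rule extended_by_trans)
  moreover have "finite_footprint R"
    using \<open>sets R \<subseteq> sets R'\<close> resourceD(4)[OF res(3)] by (rule finite_footprint_mono)
  moreover have "subalgebra Omega R"
    using \<open>sets R \<subseteq> sets R'\<close> resourceD(2)[OF res(3)] by (auto simp: subalgebra_def space_R)
  ultimately have "R \<in> resources"
    unfolding resources_def by blast
  moreover have "emeasure R (E \<inter> F) = emeasure P E * emeasure Q F" if "E \<in> sets P" "F \<in> sets Q" for E F
  proof -
    have "E \<in> sets R" "F \<in> sets R"
      using that by (auto simp: sets_R)
    then have "emeasure R (E \<inter> F) = emeasure R' (E \<inter> F)"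
      using R_le by (auto simp: extended_by_def)
    moreover have "F \<in> sets Q'" "emeasure Q F = emeasure Q' F"
      using \<open>Q \<sqsubseteq>\<^sub>r Q'\<close> that by (auto simp: extended_by_def subalgebra_def)
    ultimately show ?thesis
      using ind that by simp
  qed
  ultimately show ?thesis
    using R_le res \<open>Q \<in> resources\<close> sets_R by (auto simp: indep_comb_def)
qed

lemma sat_as_eq_mono:
  assumes "P \<sqsubseteq>\<^sub>r Q" "sat_as_eq P A X B Y"
  shows "sat_as_eq Q A X B Y"
proof -
  have "sets P \<subseteq> sets Q" "\<And>F. F \<in> sets P \<Longrightarrow> emeasure Q F = emeasure P F"
    using assms(1) by (auto simp: extended_by_def subalgebra_def)
  with assms(2) show ?thesis
    unfolding sat_as_eq_def Let_def by (simp add: subset_iff)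
qed

text \<open>Implication is closed under extension by its clause. The wand and the weakest
  precondition quantify over frames, and \<open>indep_comb_mono\<close> shrinks a frame combination
  to the smaller resource. For conditioning, every extension of the larger resource extends the
  smaller one, and the restrictions of one \<open>\<nu> x\<close> to nested \<sigma>-algebras are
  again ordered.\<close>

lemma sat_mono:
  assumes "\<P> \<in> resources" "\<P>' \<in> resources" "\<P> \<sqsubseteq>\<^sub>r \<P>'" "sat P \<Delta> \<gamma> D \<P>"
  shows "sat P \<Delta> \<gamma> D \<P>'"
  using assms
proof (induction P arbitrary: \<Delta> \<gamma> D \<P> \<P>')
  case (PImp P Q)
  then show ?case
    unfolding sat.simps by (meson extended_by_trans)
next
  case (Star P Q)
  from Star.prems(4) obtain \<P>\<^sub>P \<P>\<^sub>Q R where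
    "\<P>\<^sub>P \<in> resources" "\<P>\<^sub>Q \<in> resources" "indep_comb \<P>\<^sub>P \<P>\<^sub>Q R" "R \<sqsubseteq>\<^sub>r \<P>"
    "sat P \<Delta> \<gamma> D \<P>\<^sub>P" "sat Q \<Delta> \<gamma> D \<P>\<^sub>Q"
    unfolding sat.simps by blast
  moreover have "R \<sqsubseteq>\<^sub>r \<P>'"
    using \<open>R \<sqsubseteq>\<^sub>r \<P>\<close> Star.prems(3) by (rule extended_by_trans)
  ultimately show ?case
    unfolding sat.simps by blast
next
  case (Wand P Q)
  show ?case
    unfolding sat.simps
  proof (intro ballI allI impI)
    fix P1 R' assume P1: "P1 \<in> resources" "indep_comb P1 \<P>' R'" "sat P \<Delta> \<gamma> D P1"
    obtain R where R: "indep_comb P1 \<P> R" "R \<sqsubseteq>\<^sub>r R'"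
      using indep_comb_mono[OF P1(2) Wand.prems(1,3)] by blast
    then have "sat Q \<Delta> \<gamma> D R"
      using Wand.prems(4) P1 by auto
    then show "sat Q \<Delta> \<gamma> D R'"
      using Wand.IH(2) R P1(2) by (auto simp: indep_comb_def)
  qed
next
  case (Dist A E m)
  then show ?case
    unfolding sat.simps
    using extended_by_distr[OF Dist.prems(3)] extended_by_measurable[OF Dist.prems(3)] by metis
next
  case (Own A E)
  then show ?case
    unfolding sat.simps using extended_by_measurable by blast
next
  case (AsEq A1 E1 A2 E2)
  then show ?case
    unfolding sat.simps by (blast intro: sat_as_eq_mono)
next
  case (Expect E e)
  then show ?case
    unfolding sat.simps
    using extended_by_has_bochner_integral[OF Expect.prems(3)] extended_by_measurable[OF Expect.prems(3)] by blast
next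
  case (WP M A Q)
  show ?case
    unfolding sat.simps
  proof (intro ballI allI impI)
    fix \<P>\<^sub>f \<mu> R' and \<Delta>\<^sub>e :: "(real + 'a) measure list" and D\<^sub>e
    assume h: "\<P>\<^sub>f \<in> resources" "\<mu> \<in> space (prob_algebra Omega)" "indep_comb \<P>\<^sub>f \<P>' R'" "R' \<sqsubseteq>\<^sub>r \<mu>"
      "D\<^sub>e \<in> RV (rv_ctx \<Delta>\<^sub>e)"
    obtain R where R: "indep_comb \<P>\<^sub>f \<P> R" "R \<sqsubseteq>\<^sub>r R'"
      using indep_comb_mono[OF h(3) WP.prems(1,3)] by blast
    have "R \<sqsubseteq>\<^sub>r \<mu>"
      using R(2) h(4) by (rule extended_by_trans)
    from WP.prems(4)[unfolded sat.simps, rule_format, OF h(1,2) R(1) this h(5)]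
    show "\<exists>X\<in>RV A. \<exists>\<P>'\<in>resources. \<exists>\<mu>'\<in>space (prob_algebra Omega). \<exists>\<R>'.
             indep_comb \<P>\<^sub>f \<P>' \<R>' \<and> \<R>' \<sqsubseteq>\<^sub>r \<mu>' \<and>
             (let N = rv_ctx \<Delta>\<^sub>e \<Otimes>\<^sub>M (rv_ctx \<Delta> \<Otimes>\<^sub>M A) in
                bind \<mu> (\<lambda>\<omega>. bind (M \<gamma> (D \<omega>)) (\<lambda>v. return N (D\<^sub>e \<omega>, D \<omega>, v)))
                = distr \<mu>' N (\<lambda>\<omega>. (D\<^sub>e \<omega>, D \<omega>, X \<omega>))) \<and>
             sat Q (\<Delta> @ [A]) \<gamma> (rv_extend \<Delta> D X) \<P>'" .
  qed
next
  case (Cond A E P)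
  show ?case
    unfolding sat.simps
  proof (intro ballI allI impI)
    fix \<mu> \<nu> assume \<mu>: "\<mu> \<in> space (prob_algebra Omega)" "\<P>' \<sqsubseteq>\<^sub>r \<mu>" and \<nu>: "disintegration \<mu> A (E \<gamma> \<circ> D) \<nu>"
    have "\<P> \<sqsubseteq>\<^sub>r \<mu>"
      using Cond.prems(3) \<mu>(2) by (rule extended_by_trans)
    then have "AE x in distr \<mu> A (E \<gamma> \<circ> D). sat P \<Delta> (\<gamma> @ [x]) D (restr_to_subalg (\<nu> x) \<P>)"
      using Cond.prems(4) \<mu>(1) \<nu> by auto
    then show "AE x in distr \<mu> A (E \<gamma> \<circ> D). sat P \<Delta> (\<gamma> @ [x]) D (restr_to_subalg (\<nu> x) \<P>')"
      using AE_space
    proof eventually_elim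
      case (elim x)
      then have \<nu>x: "\<nu> x \<in> space (prob_algebra Omega)"
        using \<nu> by (simp add: disintegration_def)
      have "restr_to_subalg (\<nu> x) \<P> \<sqsubseteq>\<^sub>r restr_to_subalg (\<nu> x) \<P>'"
        using Cond.prems(3) subalgebra_prob_algebra[OF \<nu>x resourceD(2)[OF Cond.prems(2)]]
        by (intro restr_extended_by_restr) (auto simp: extended_by_def subalgebra_def)
      then show ?case
        using Cond.IH[OF restr_in_resources[OF Cond.prems(1) \<nu>x] restr_in_resources[OF Cond.prems(2) \<nu>x]] elim(1)
        by blast
    qed
  qed
next
  case (ExRV A P)
  then show ?case unfolding sat.simps by blast
next
  case (AllRV A P)
  then show ?case unfolding sat.simps by blast
next
  case (PEx A P)
  then show ?case unfolding sat.simps by blast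
next
  case (PAll A P)
  then show ?case unfolding sat.simps by blast
next
  case (PAnd P Q)
  then show ?case unfolding sat.simps by blast
next
  case (POr P Q)
  then show ?case unfolding sat.simps by blast
qed simp_all


section \<open>The conditioning rules\<close>

text \<open>The equation \<open>p - n = r\<close> between positive part, negative part and mean is
  written with sums only. As \<open>ennreal\<close> maps negative numbers to 0,
  \<open>ennreal r\<close> and \<open>ennreal (- r)\<close> are the positive and negative parts of
  \<open>r\<close>. In this form it can be integrated over \<open>x\<close> without integrability
  conditions.\<close>

lemma has_bochner_integral_real_iff:
  fixes f :: "'a \<Rightarrow> real"
  shows "has_bochner_integral M f r \<longleftrightarrow> f \<in> borel_measurable M \<and>
    (\<integral>\<^sup>+x. ennreal (f x) \<partial>M) < \<infinity> \<and> (\<integral>\<^sup>+x. ennreal (- f x) \<partial>M) < \<infinity> \<and>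
    (\<integral>\<^sup>+x. ennreal (f x) \<partial>M) + ennreal (- r) = (\<integral>\<^sup>+x. ennreal (- f x) \<partial>M) + ennreal r"
    (is "_ \<longleftrightarrow> _ \<and> ?p < _ \<and> ?n < _ \<and> _")
proof -
  have "integral\<^sup>L M f = r \<longleftrightarrow> ?p + ennreal (- r) = ?n + ennreal r" if "integrable M f"
  proof -
    have "?p \<noteq> \<infinity>" "?n \<noteq> \<infinity>"
      using that by (simp_all add: real_integrable_def)
    then obtain p n where pn: "?p = ennreal p" "0 \<le> p" "?n = ennreal n" "0 \<le> n"
      by (metis ennreal_cases infinity_ennreal_def)
    have "integral\<^sup>L M f = p - n"
      using pn by (simp add: real_lebesgue_integral_def[OF that])
    moreover have "?p + ennreal (- r) = ?n + ennreal r \<longleftrightarrow> p - n = r"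
      using pn by (cases "0 \<le> r") (auto simp: ennreal_plus[symmetric] ennreal_neg simp del: ennreal_plus)
    ultimately show ?thesis by simp
  qed
  then show ?thesis
    unfolding has_bochner_integral_iff by (auto simp: real_integrable_def less_top[symmetric])
qed

text \<open>All identities are between sums of nonnegative parts, so that no integrability of \<open>Z\<close> is
  presupposed; \<^const>\<open>expectation_exists\<close> is what allows the cancellation.\<close>

lemma total_expectation:
  assumes disint: "disintegration \<mu> A Y \<nu>" and \<mu>: "\<mu> \<in> space (prob_algebra Omega)"
    and Y [measurable]: "Y \<in> Omega \<rightarrow>\<^sub>M A" and Z [measurable]: "Z \<in> borel_measurable Omega"
    and e [measurable]: "e \<in> borel_measurable A"
    and ex: "expectation_exists \<mu> Z"
    and cond: "AE x in distr \<mu> A Y. has_bochner_integral (\<nu> x) Z (e x)"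
    and v: "has_bochner_integral \<mu> (\<lambda>\<omega>. e (Y \<omega>)) v"
  shows "has_bochner_integral \<mu> Z v"
proof -
  let ?L = "distr \<mu> A Y"
  have sets_\<mu> [measurable_cong]: "sets \<mu> = sets Omega"
    using \<mu> by (simp add: space_prob_algebra)
  have disint_Z: "(\<lambda>x. \<integral>\<^sup>+\<omega>. ennreal (f \<omega>) \<partial>\<nu> x) \<in> borel_measurable A"
    "(\<integral>\<^sup>+\<omega>. ennreal (f \<omega>) \<partial>\<mu>) = (\<integral>\<^sup>+x. \<integral>\<^sup>+\<omega>. ennreal (f \<omega>) \<partial>\<nu> x \<partial>?L)"
    if [measurable]: "f \<in> borel_measurable Omega" for f
  proof -
    \<comment> \<open>A disintegration is specified on nonnegative functions; truncation by
      \<open>ennreal\<close> extends its two identities to functions of any sign.\<close>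
    have pos: "ennreal (f \<omega>) = ennreal (max 0 (f \<omega>))" for \<omega>
      by (simp add: max_def ennreal_neg)
    have meas: "(\<lambda>\<omega>. max 0 (f \<omega>)) \<in> borel_measurable Omega" by measurable
    note disint' = disint[unfolded disintegration_def, THEN conjunct2]
    show "(\<lambda>x. \<integral>\<^sup>+\<omega>. ennreal (f \<omega>) \<partial>\<nu> x) \<in> borel_measurable A"
      unfolding pos using disint'[THEN conjunct1, rule_format, OF meas] by simp
    show "(\<integral>\<^sup>+\<omega>. ennreal (f \<omega>) \<partial>\<mu>) = (\<integral>\<^sup>+x. \<integral>\<^sup>+\<omega>. ennreal (f \<omega>) \<partial>\<nu> x \<partial>?L)"
      unfolding pos using disint'[THEN conjunct2, THEN conjunct2, rule_format, OF meas] by simp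
  qed
  define p where "p x = (\<integral>\<^sup>+\<omega>. ennreal (Z \<omega>) \<partial>\<nu> x)" for x
  define n where "n x = (\<integral>\<^sup>+\<omega>. ennreal (- Z \<omega>) \<partial>\<nu> x)" for x
  have [measurable]: "p \<in> borel_measurable A" "n \<in> borel_measurable A"
    unfolding p_def n_def by (auto intro!: disint_Z)
  define I where "I = (\<integral>\<^sup>+\<omega>. ennreal (Z \<omega>) \<partial>\<mu>)"
  define J where "J = (\<integral>\<^sup>+\<omega>. ennreal (- Z \<omega>) \<partial>\<mu>)"
  have IJ: "I = integral\<^sup>N ?L p" "J = integral\<^sup>N ?L n"
    unfolding I_def J_def p_def n_def by (auto intro!: disint_Z)
  define a where "a = (\<integral>\<^sup>+\<omega>. ennreal (e (Y \<omega>)) \<partial>\<mu>)"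
  define b where "b = (\<integral>\<^sup>+\<omega>. ennreal (- e (Y \<omega>)) \<partial>\<mu>)"
  have ab: "a < \<infinity>" "b < \<infinity>" "a + ennreal (- v) = b + ennreal v"
    using v unfolding has_bochner_integral_real_iff a_def b_def by auto
  \<comment> \<open>The conditional identity between positive and negative parts, integrated over
    the law of \<open>Y\<close>.\<close>
  have "I + b = (\<integral>\<^sup>+x. p x + ennreal (- e x) \<partial>?L)"
    unfolding IJ b_def by (subst nn_integral_add) (auto simp: nn_integral_distr)
  also have "\<dots> = (\<integral>\<^sup>+x. n x + ennreal (e x) \<partial>?L)"
    using cond by (intro nn_integral_cong_AE) (auto simp: has_bochner_integral_real_iff p_def n_def)
  also have "\<dots> = J + a"
    unfolding IJ a_def by (subst nn_integral_add) (auto simp: nn_integral_distr)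
  finally have eq: "I + b = J + a" .
  \<comment> \<open>With \<open>a\<close> and \<open>b\<close> finite, \<open>eq\<close> makes
    \<open>I\<close> and \<open>J\<close> finite together or infinite together; \<open>ex\<close>
    rules out the latter.\<close>
  have fin: "I < \<infinity>" "J < \<infinity>"
    using ex eq ab(1,2) unfolding expectation_exists_def I_def[symmetric] J_def[symmetric]
    by (auto simp: less_top[symmetric]) (metis ennreal_add_eq_top)+
  \<comment> \<open>Both balance equations are added, and the common finite summand
    \<open>b + a\<close> is then cancelled.\<close>
  have "(b + a) + (I + ennreal (- v)) = (I + b) + (a + ennreal (- v))"
    by (simp add: ac_simps)
  also have "\<dots> = (J + a) + (b + ennreal v)"
    by (simp only: eq ab(3))
  also have "\<dots> = (b + a) + (J + ennreal v)"
    by (simp add: ac_simps)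
  finally have "I + ennreal (- v) = J + ennreal v"
    using ab(1,2) by (auto simp: ennreal_add_left_cancel)
  with fin show ?thesis
    unfolding has_bochner_integral_real_iff I_def[symmetric] J_def[symmetric]
    by (auto cong: measurable_cong_sets)
qed

text \<open>For \<open>F\<close> in \<open>Q\<close> the integral of
  \<open>emeasure (\<nu> x) F\<close> over \<open>B\<close> is the mass of \<open>Y -\<close> B
  \<inter> F\<open>, which factorises because\<close>Y -\<open>B\<close> lies in \<open>P\<close>.
  So the constant \<open>emeasure Q F\<close> is another version of the same conditional
  probability, and versions agree almost everywhere.\<close>

lemma disintegration_restr_indep:
  assumes disint: "disintegration \<mu> A Y \<nu>" and \<mu>: "\<mu> \<in> space (prob_algebra Omega)"
    and Y: "Y \<in> P \<rightarrow>\<^sub>M A" and comb: "indep_comb P Q R" and "R \<sqsubseteq>\<^sub>r \<mu>"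
  shows "AE x in distr \<mu> A Y. restr_to_subalg (\<nu> x) Q = Q"
proof -
  let ?L = "distr \<mu> A Y"
  have sets_\<mu>: "sets \<mu> = sets Omega" and "prob_space \<mu>"
    using \<mu> by (auto simp: space_prob_algebra)
  have space_\<mu>: "space \<mu> = space Omega"
    using \<mu> by (rule prob_algebra_space_eq)
  have res: "P \<in> resources" "Q \<in> resources" and
    ind: "\<And>E F. E \<in> sets P \<Longrightarrow> F \<in> sets Q \<Longrightarrow> emeasure R (E \<inter> F) = emeasure P E * emeasure Q F"
    using comb by (auto simp: indep_comb_def)
  note sub = resourceD(2)[OF res(1)] resourceD(2)[OF res(2)]
  have P: "P \<sqsubseteq>\<^sub>r \<mu>" and Q: "Q \<sqsubseteq>\<^sub>r \<mu>"
    using indep_comb_extends[OF comb] \<open>R \<sqsubseteq>\<^sub>r \<mu>\<close> extended_by_trans by blast+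
  have Y': "Y \<in> Omega \<rightarrow>\<^sub>M A"
    using sub(1) Y by (rule measurable_from_subalg)
  then have Y\<mu>: "Y \<in> \<mu> \<rightarrow>\<^sub>M A"
    by (simp add: sets_\<mu> cong: measurable_cong_sets)
  interpret law: prob_space ?L
    using \<open>prob_space \<mu>\<close> Y\<mu> by (rule prob_space.prob_space_distr)
  have space: "space P = space Omega" "space Q = space Omega"
    using sub by (auto simp: subalgebra_def)
  have emeasure_\<nu>: "AE x in ?L. emeasure (\<nu> x) F = emeasure Q F" if F: "F \<in> sets Q" for F
  proof (rule law.density_unique_finite_measure)
    have F': "F \<in> sets Omega"
      using F sub(2) by (auto simp: subalgebra_def)
    then show "(\<lambda>x. emeasure (\<nu> x) F) \<in> borel_measurable ?L"
      using disintegration_measurable[OF disint] by simp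
    fix B assume "B \<in> sets ?L"
    then have B: "B \<in> sets A" by simp
    have E: "Y -` B \<inter> space Omega \<in> sets P"
      using measurable_sets[OF Y B] by (simp add: space)
    have EF: "(Y -` B \<inter> space Omega) \<inter> F \<in> sets R"
      using E F indep_comb_extends[OF comb] by (auto simp: extended_by_def subalgebra_def)
    have "(\<integral>\<^sup>+x. emeasure (\<nu> x) F * indicator B x \<partial>?L) = emeasure \<mu> (Y -` B \<inter> F)"
      by (rule disintegration_Int[OF disint \<mu> Y' B F'])
    also have "Y -` B \<inter> F = (Y -` B \<inter> space Omega) \<inter> F"
      using sets.sets_into_space[OF F'] by auto
    also have "emeasure \<mu> \<dots> = emeasure R \<dots>"
      using \<open>R \<sqsubseteq>\<^sub>r \<mu>\<close> EF by (simp add: extended_by_def)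
    also have "\<dots> = emeasure P (Y -` B \<inter> space Omega) * emeasure Q F"
      by (rule ind[OF E F])
    also have "emeasure P (Y -` B \<inter> space Omega) = emeasure ?L B"
      using E P by (simp add: emeasure_distr[OF Y\<mu> B] space_\<mu> extended_by_def)
    also have "emeasure ?L B * emeasure Q F = (\<integral>\<^sup>+x. emeasure Q F * indicator B x \<partial>?L)"
      using B by (subst nn_integral_cmult) (auto simp: mult.commute intro!: borel_measurable_indicator)
    finally show "(\<integral>\<^sup>+x. emeasure (\<nu> x) F * indicator B x \<partial>?L) = (\<integral>\<^sup>+x. emeasure Q F * indicator B x \<partial>?L)" .
  qed auto
  obtain G where G: "countable G" "Int_stable G" "G \<subseteq> Pow (space Q)" "space Q \<in> G"
    "sets Q = sigma_sets (space Q) G"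
    using countably_generated_Int_stable[OF resourceD(3)[OF res(2)]] by blast
  have G_sets: "G \<subseteq> sets Q"
    unfolding G(5) by auto
  have "AE x in ?L. \<forall>F\<in>G. emeasure (\<nu> x) F = emeasure Q F"
    using G(1) G_sets by (auto simp: AE_ball_countable intro!: emeasure_\<nu>)
  then show ?thesis
    using AE_space
  proof eventually_elim
    case (elim x)
    then have "\<nu> x \<in> space (prob_algebra Omega)"
      using disint by (simp add: disintegration_def)
    then have sub_x: "subalgebra (\<nu> x) Q"
      using sub(2) by (rule subalgebra_prob_algebra)
    \<comment> \<open>The constant sequence \<open>space Q\<close> serves as the exhaustion, which
      is possible because the generator contains the whole space.\<close>
    show ?case
    proof (rule measure_eqI_generator_eq[OF G(2,3), where A = "\<lambda>_. space Q"])
      fix F assume "F \<in> G"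
      then show "emeasure (restr_to_subalg (\<nu> x) Q) F = emeasure Q F"
        using elim(1) G_sets by (auto simp: emeasure_restr_to_subalg[OF sub_x])
    next
      have "emeasure (restr_to_subalg (\<nu> x) Q) (space Q) = emeasure Q (space Q)"
        using elim(1) G(4) by (simp add: emeasure_restr_to_subalg[OF sub_x])
      then show "emeasure (restr_to_subalg (\<nu> x) Q) (space Q) \<noteq> \<infinity>"
        using prob_space.emeasure_space_1[OF resourceD(1)[OF res(2)]] by simp
    qed (use G in \<open>auto simp: sets_restr_to_subalg[OF sub_x]\<close>)
  qed
qed

section \<open>Validity of the four rules\<close>

lemma rand_expr_measurable:
  assumes "rand_expr \<Gamma> \<Delta> A E" "\<gamma> \<in> det_env \<Gamma>" "D \<in> RV (rv_ctx \<Delta>)"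
  shows "E \<gamma> \<circ> D \<in> Omega \<rightarrow>\<^sub>M A"
  using assms by (intro measurable_comp[of D Omega "rv_ctx \<Delta>"]) (simp_all add: rand_expr_def RV_def)

lemma det_env_length: "\<gamma> \<in> det_env \<Gamma> \<Longrightarrow> length \<gamma> = length \<Gamma>"
  by (auto simp: det_env_def dest: list_all2_lengthD)

lemma det_env_snoc: "\<gamma> \<in> det_env \<Gamma> \<Longrightarrow> x \<in> S \<Longrightarrow> \<gamma> @ [x] \<in> det_env (\<Gamma> @ [S])"
  by (auto simp: det_env_def intro: list_all2_appendI)

lemma drop_var_snoc [simp]: "drop_var (length \<gamma>) (\<gamma> @ [x]) = \<gamma>"
  by (simp add: drop_var_def)

text \<open>The assumed entailment is applied at almost every \<open>x\<close>:
  \<open>AE_space\<close> puts \<open>x\<close> into \<open>space A\<close>, so the extended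
  environment is legitimate, and the restricted law is again a resource.\<close>

lemma cond_entail:
  assumes "entails (\<Gamma> @ [space A]) \<Delta> P Q"
  shows "entails \<Gamma> \<Delta> (Cond A E P) (Cond A E Q)"
  unfolding entails_def
proof (intro ballI impI)
  fix \<gamma> D \<P>
  assume \<gamma>: "\<gamma> \<in> det_env \<Gamma>" and D: "D \<in> RV (rv_ctx \<Delta>)" and \<P>: "\<P> \<in> resources"
    and P: "sat (Cond A E P) \<Delta> \<gamma> D \<P>"
  show "sat (Cond A E Q) \<Delta> \<gamma> D \<P>"
    unfolding sat.simps
  proof (intro ballI allI impI)
    fix \<mu> \<nu> assume \<mu>: "\<mu> \<in> space (prob_algebra Omega)" "\<P> \<sqsubseteq>\<^sub>r \<mu>" and \<nu>: "disintegration \<mu> A (E \<gamma> \<circ> D) \<nu>"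
    then have "AE x in distr \<mu> A (E \<gamma> \<circ> D). sat P \<Delta> (\<gamma> @ [x]) D (restr_to_subalg (\<nu> x) \<P>)"
      using P unfolding sat.simps by blast
    then show "AE x in distr \<mu> A (E \<gamma> \<circ> D). sat Q \<Delta> (\<gamma> @ [x]) D (restr_to_subalg (\<nu> x) \<P>)"
      using AE_space
    proof eventually_elim
      case (elim x)
      then have "\<nu> x \<in> space (prob_algebra Omega)" "\<gamma> @ [x] \<in> det_env (\<Gamma> @ [space A])"
        using \<nu> det_env_snoc[OF \<gamma>] by (auto simp: disintegration_def)
      then show ?case
        using assms D elim(1) restr_in_resources[OF \<P>] unfolding entails_def by blast
    qed
  qed
qed

text \<open>Almost every \<open>\<nu> x\<close> leaves the part satisfying \<open>P\<close>
  unchanged; its restriction to the whole resource extends that part, so \<open>sat_mono\<close>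
  transfers \<open>P\<close>, and weakening discards \<open>x\<close>.\<close>

lemma cond_indep:
  "entails \<Gamma> \<Delta> (Star (Own A E) P) (Cond A E (weaken (length \<Gamma>) P))"
  unfolding entails_def
proof (intro ballI impI)
  fix \<gamma> D \<P>
  assume \<gamma>: "\<gamma> \<in> det_env \<Gamma>" and D: "D \<in> RV (rv_ctx \<Delta>)" and \<P>: "\<P> \<in> resources"
    and "sat (Star (Own A E) P) \<Delta> \<gamma> D \<P>"
  then obtain \<P>\<^sub>E \<P>\<^sub>P \<R> where res: "\<P>\<^sub>E \<in> resources" "\<P>\<^sub>P \<in> resources" and comb: "indep_comb \<P>\<^sub>E \<P>\<^sub>P \<R>"
    and le: "\<R> \<sqsubseteq>\<^sub>r \<P>" and own: "E \<gamma> \<circ> D \<in> \<P>\<^sub>E \<rightarrow>\<^sub>M A" and P: "sat P \<Delta> \<gamma> D \<P>\<^sub>P"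
    unfolding sat.simps by blast
  have le_P: "\<P>\<^sub>P \<sqsubseteq>\<^sub>r \<P>"
    using indep_comb_extends(2)[OF comb] le by (rule extended_by_trans)
  show "sat (Cond A E (weaken (length \<Gamma>) P)) \<Delta> \<gamma> D \<P>"
    unfolding sat.simps
  proof (intro ballI allI impI)
    fix \<mu> \<nu> assume \<mu>: "\<mu> \<in> space (prob_algebra Omega)" "\<P> \<sqsubseteq>\<^sub>r \<mu>" and \<nu>: "disintegration \<mu> A (E \<gamma> \<circ> D) \<nu>"
    have "\<R> \<sqsubseteq>\<^sub>r \<mu>"
      using le \<mu>(2) by (rule extended_by_trans)
    from disintegration_restr_indep[OF \<nu> \<mu>(1) own comb this] AE_space
    show "AE x in distr \<mu> A (E \<gamma> \<circ> D). sat (weaken (length \<Gamma>) P) \<Delta> (\<gamma> @ [x]) D (restr_to_subalg (\<nu> x) \<P>)"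
    proof eventually_elim
      case (elim x)
      have \<nu>x: "\<nu> x \<in> space (prob_algebra Omega)"
        using elim(2) \<nu> by (simp add: disintegration_def)
      have "restr_to_subalg (\<nu> x) \<P>\<^sub>P \<sqsubseteq>\<^sub>r restr_to_subalg (\<nu> x) \<P>"
        using le_P subalgebra_prob_algebra[OF \<nu>x resourceD(2)[OF \<P>]]
        by (intro restr_extended_by_restr) (auto simp: extended_by_def subalgebra_def)
      then have "sat P \<Delta> \<gamma> D (restr_to_subalg (\<nu> x) \<P>)"
        using sat_mono[OF res(2) restr_in_resources[OF \<P> \<nu>x] _ P] elim(1) by simp
      then show ?case
        by (simp add: sat_weaken flip: det_env_length[OF \<gamma>])
    qed
  qed
qed

text \<open>The fibre condition is the almost sure equality itself. The fibre is an event of the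
  resource because singletons are measurable and \<open>X\<close> is owned, and pairing with the
  constant \<open>x\<close> keeps \<open>X\<close> measurable. The term
  \<open>\<gamma> ! length \<Gamma>\<close> reads the newest deterministic variable.\<close>

lemma cond_subst:
  assumes A: "conditionable A"
  shows "entails \<Gamma> \<Delta> (Own A X) (Cond A X (AsEq A (X \<circ> drop_var (length \<Gamma>)) A (\<lambda>\<gamma> \<delta>. \<gamma> ! length \<Gamma>)))"
  unfolding entails_def
proof (intro ballI impI)
  fix \<gamma> D \<P>
  assume \<gamma>: "\<gamma> \<in> det_env \<Gamma>" and \<P>: "\<P> \<in> resources" and "sat (Own A X) \<Delta> \<gamma> D \<P>"
  define Y where "Y = X \<gamma> \<circ> D"
  have Y [measurable]: "Y \<in> \<P> \<rightarrow>\<^sub>M A"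
    using \<open>sat (Own A X) \<Delta> \<gamma> D \<P>\<close> by (simp add: Y_def)
  have space: "space \<P> = space Omega"
    using resourceD(2)[OF \<P>] by (simp add: subalgebra_def)
  show "sat (Cond A X (AsEq A (X \<circ> drop_var (length \<Gamma>)) A (\<lambda>\<gamma> \<delta>. \<gamma> ! length \<Gamma>))) \<Delta> \<gamma> D \<P>"
    unfolding sat.simps Y_def[symmetric]
  proof (intro ballI allI impI)
    fix \<mu> \<nu> assume \<nu>: "disintegration \<mu> A Y \<nu>"
    then have "AE x in distr \<mu> A Y. emeasure (\<nu> x) {\<omega>\<in>space Omega. Y \<omega> = x} = 1"
      by (simp add: disintegration_def)
    then show "AE x in distr \<mu> A Y. sat_as_eq (restr_to_subalg (\<nu> x) \<P>)
        A ((X \<circ> drop_var (length \<Gamma>)) (\<gamma> @ [x]) \<circ> D) A ((\<lambda>\<delta>. (\<gamma> @ [x]) ! length \<Gamma>) \<circ> D)"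
      using AE_space
    proof eventually_elim
      case (elim x)
      then have x: "x \<in> space A" by simp
      then have "subalgebra (\<nu> x) \<P>"
        using \<nu> by (intro subalgebra_prob_algebra[OF _ resourceD(2)[OF \<P>]]) (simp add: disintegration_def)
      note sub = sets_restr_to_subalg[OF this] emeasure_restr_to_subalg[OF this]
      have "{x} \<in> sets A"
        using A x by (simp add: conditionable_def)
      from measurable_sets[OF Y this] have F: "{\<omega>\<in>space Omega. Y \<omega> = x} \<in> sets \<P>"
        by (simp add: space vimage_def Int_def conj_commute)
      have "{\<omega>\<in>space Omega. (Y \<omega>, x) \<in> B} \<in> sets \<P>" if [measurable]: "B \<in> sets (A \<Otimes>\<^sub>M A)" for B
      proof -
        have "(\<lambda>\<omega>. (Y \<omega>, x)) \<in> \<P> \<rightarrow>\<^sub>M A \<Otimes>\<^sub>M A"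
          using x by measurable
        from measurable_sets[OF this that] show ?thesis
          by (simp add: space vimage_def Int_def conj_commute)
      qed
      then have "sat_as_eq (restr_to_subalg (\<nu> x) \<P>) A Y A (\<lambda>_. x)"
        using F elim(1) by (simp add: sat_as_eq_def Let_def sub sets.Un)
      then show ?case
        by (simp add: Y_def o_def nth_append flip: det_env_length[OF \<gamma>])
    qed
  qed
qed

text \<open>A resource comes with an extension \<mu>, and \<open>disintegration_exists\<close>
  supplies a \<nu> at which to instantiate the conditioning clause. Expectations are then moved
  between the resource and \<mu>, and between each restriction and \<open>\<nu> x\<close>.\<close>

lemma cond_total_expectation:
  assumes A: "conditionable A" and X: "rand_expr \<Gamma> \<Delta> A X"
    and e: "(\<lambda>x. e (\<gamma> @ [x])) \<in> borel_measurable A"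
    and \<gamma>: "\<gamma> \<in> det_env \<Gamma>" and D: "D \<in> RV (rv_ctx \<Delta>)" and \<P>: "\<P> \<in> resources"
    and ex: "expectation_exists \<P> (E \<gamma> \<circ> D)"
    and cond: "sat (Cond A X (Expect (E \<circ> drop_var (length \<Gamma>)) e)) \<Delta> \<gamma> D \<P>"
    and v: "sat (Expect (\<lambda>\<gamma> \<delta>. e (\<gamma> @ [X \<gamma> \<delta>])) v) \<Delta> \<gamma> D \<P>"
  shows "sat (Expect E v) \<Delta> \<gamma> D \<P>"
proof -
  obtain \<mu> where \<mu>: "\<mu> \<in> space (prob_algebra Omega)" and le: "\<P> \<sqsubseteq>\<^sub>r \<mu>"
    using \<P> by (auto simp: resources_def)
  define Y where "Y = X \<gamma> \<circ> D"
  define Z where "Z = E \<gamma> \<circ> D"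
  have Y: "Y \<in> Omega \<rightarrow>\<^sub>M A"
    unfolding Y_def by (rule rand_expr_measurable[OF X \<gamma> D])
  obtain \<nu> where \<nu>: "disintegration \<mu> A Y \<nu>"
    using disintegration_exists[OF A \<mu> Y] by blast
  have "Y \<in> \<mu> \<rightarrow>\<^sub>M A"
    using Y \<mu> by (simp add: space_prob_algebra cong: measurable_cong_sets)
  then interpret law: prob_space "distr \<mu> A Y"
    using \<mu> by (intro prob_space.prob_space_distr) (simp_all add: space_prob_algebra)
  have "AE x in distr \<mu> A Y. sat (Expect (E \<circ> drop_var (length \<Gamma>)) e) \<Delta> (\<gamma> @ [x]) D (restr_to_subalg (\<nu> x) \<P>)"
    using cond \<mu> le \<nu> unfolding sat.simps(18) Y_def by blast
  then have "AE x in distr \<mu> A Y. Z \<in> borel_measurable \<P> \<and> has_bochner_integral (\<nu> x) Z (e (\<gamma> @ [x]))"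
    using AE_space
  proof eventually_elim
    case (elim x)
    then have sub: "subalgebra (\<nu> x) \<P>"
      using \<nu> by (intro subalgebra_prob_algebra[OF _ resourceD(2)[OF \<P>]]) (simp add: disintegration_def)
    have Z: "Z \<in> borel_measurable (restr_to_subalg (\<nu> x) \<P>)"
      and int: "has_bochner_integral (restr_to_subalg (\<nu> x) \<P>) Z (e (\<gamma> @ [x]))"
      using elim(1) by (simp_all add: Z_def flip: det_env_length[OF \<gamma>])
    then show ?case
      using measurable_in_subalg'[OF sub Z] extended_by_has_bochner_integral[OF restr_extended_by[OF sub] Z] by blast
  qed
  \<comment> \<open>Measurability of \<open>Z\<close> does not mention \<open>x\<close>; holding
    almost surely under a probability law, it holds outright.\<close>
  then have cond': "AE x in distr \<mu> A Y. has_bochner_integral (\<nu> x) Z (e (\<gamma> @ [x]))"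
    and Z: "Z \<in> borel_measurable \<P>"
    by (auto dest: law.AE_contr)
  have Z': "Z \<in> borel_measurable Omega"
    using resourceD(2)[OF \<P>] Z by (rule measurable_from_subalg)
  have "has_bochner_integral \<mu> Z (v \<gamma>)"
  proof (rule total_expectation[OF \<nu> \<mu> Y Z' e])
    show "expectation_exists \<mu> Z"
      using ex Z extended_by_nn_integral[OF le, of "\<lambda>\<omega>. ennreal (Z \<omega>)"]
        extended_by_nn_integral[OF le, of "\<lambda>\<omega>. ennreal (- Z \<omega>)"]
      by (simp add: expectation_exists_def Z_def[symmetric])
    show "has_bochner_integral \<mu> (\<lambda>\<omega>. e (\<gamma> @ [Y \<omega>])) (v \<gamma>)"
      using v extended_by_has_bochner_integral[OF le, of "\<lambda>\<omega>. e (\<gamma> @ [Y \<omega>])"] by (simp add: Y_def o_def)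
  qed (rule cond')
  then show ?thesis
    using Z extended_by_has_bochner_integral[OF le Z] by (simp add: Z_def)
qed

theorem lemma3p4:
  fixes \<Gamma> :: "'v set list" and \<Delta> :: "'v measure list" and A :: "'v measure"
  assumes "conditionable A"
  shows
    "(\<forall>E P Q. rand_expr \<Gamma> \<Delta> A E \<longrightarrow>
        wf_prop P (\<Gamma> @ [space A]) \<Delta> \<longrightarrow> wf_prop Q (\<Gamma> @ [space A]) \<Delta> \<longrightarrow>
        entails (\<Gamma> @ [space A]) \<Delta> P Q \<longrightarrow>
        entails \<Gamma> \<Delta> (Cond A E P) (Cond A E Q))
     \<and>
     (\<forall>E P. rand_expr \<Gamma> \<Delta> A E \<longrightarrow> wf_prop P \<Gamma> \<Delta> \<longrightarrow>
        entails \<Gamma> \<Delta> (Star (Own A E) P) (Cond A E (weaken (length \<Gamma>) P)))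
     \<and>
     (\<forall>X. rand_expr \<Gamma> \<Delta> A X \<longrightarrow>
        entails \<Gamma> \<Delta> (Own A X)
          (Cond A X (AsEq A (X \<circ> drop_var (length \<Gamma>)) A (\<lambda>\<gamma> \<delta>. \<gamma> ! length \<Gamma>))))
     \<and>
     (\<forall>X E e v. rand_expr \<Gamma> \<Delta> A X \<longrightarrow> rand_expr \<Gamma> \<Delta> borel E \<longrightarrow>
        (\<forall>\<gamma>\<in>det_env \<Gamma>. (\<lambda>x. e (\<gamma> @ [x])) \<in> borel_measurable A) \<longrightarrow>
        (\<forall>\<gamma>\<in>det_env \<Gamma>. \<forall>D\<in>RV (rv_ctx \<Delta>). \<forall>\<P>\<in>resources.
           expectation_exists \<P> (E \<gamma> \<circ> D) \<longrightarrow>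
           sat (PAnd (Cond A X (Expect (E \<circ> drop_var (length \<Gamma>)) e))
                     (Expect (\<lambda>\<gamma> \<delta>. e (\<gamma> @ [X \<gamma> \<delta>])) v)) \<Delta> \<gamma> D \<P> \<longrightarrow>
           sat (Expect E v) \<Delta> \<gamma> D \<P>))"
proof (intro conjI allI impI ballI)
  show "entails \<Gamma> \<Delta> (Cond A E P) (Cond A E Q)" if "entails (\<Gamma> @ [space A]) \<Delta> P Q" for E P Q
    using that by (rule cond_entail)
  show "entails \<Gamma> \<Delta> (Star (Own A E) P) (Cond A E (weaken (length \<Gamma>) P))" for E P
    by (rule cond_indep)
  show "entails \<Gamma> \<Delta> (Own A X) (Cond A X (AsEq A (X \<circ> drop_var (length \<Gamma>)) A (\<lambda>\<gamma> \<delta>. \<gamma> ! length \<Gamma>)))" for X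
    using assms by (rule cond_subst)
  show "sat (Expect E v) \<Delta> \<gamma> D \<P>"
    if "rand_expr \<Gamma> \<Delta> A X" and e: "\<forall>\<gamma>\<in>det_env \<Gamma>. (\<lambda>x. e (\<gamma> @ [x])) \<in> borel_measurable A"
      and \<gamma>: "\<gamma> \<in> det_env \<Gamma>" and "D \<in> RV (rv_ctx \<Delta>)" "\<P> \<in> resources" "expectation_exists \<P> (E \<gamma> \<circ> D)"
      and "sat (PAnd (Cond A X (Expect (E \<circ> drop_var (length \<Gamma>)) e))
          (Expect (\<lambda>\<gamma> \<delta>. e (\<gamma> @ [X \<gamma> \<delta>])) v)) \<Delta> \<gamma> D \<P>" for X E e v \<gamma> D \<P>
    using cond_total_expectation[where E = E and e = e and v = v, OF assms that(1) e[rule_format, OF \<gamma>] \<gamma> that(4-6)] that(7)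
    unfolding sat.simps(3) by blast
qed

end
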